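(* Let $\sigma_m$ be the $m$-variable geodesic mean associated with a probability measure $\nu$ on $\Sigma_m$. Then, for every $A_1,\dots,A_m\in\mathbb{P}_n$, $$\left(\sum_{i=1}^m\overline{w}_iA_i^{-1}\right)^{-1}\le\sigma_m(A_1,\dots,A_m)\le\sum_{i=1}^m\overline{w}_iA_i,$$ where $\overline{w}_i:=\int_{\Sigma_m}w_i\,d\nu(\mathbf{w})$, $1\le i\le m$. In particular, $$m\left(\sum_{i=1}^mA_i^{-1}\right)^{-1}\le L_m(A_1,\dots,A_m)\le\frac1m\sum_{i=1}^mA_i.$$
   Context: $\mathbb{P}_n$ is the set of positive definite $n\times n$ complex matrices and $\le$ is the Loewner order. On $\mathbb{P}_n$ let $\delta(A,B)=\|\log A^{-1/2}BA^{-1/2}\|_2$, with $\|\cdot\|_2$ the Hilbert–Schmidt norm. Let $\Sigma_m=\{\mathbf{w}=(w_1,\dots,w_m):w_i\ge0,\ \sum_iw_i=1\}$. For $\mathbf{w}\in\Sigma_m$ and $A_1,\dots,A_m\in\mathbb{P}_n$, the weighted geometric mean $G_m(\mathbf{w};A_1,\dots,A_m)$ is the unique minimizer over $X\in\mathbb{P}_n$ of $\sum_{i=1}^mw_i\delta^2(X,A_i)$. For a probability measure $\nu$ on $\Sigma_m$, the associated $m$-variable geodesic mean is $\sigma_m(A_1,\dots,A_m)=\int_{\Sigma_m}G_m(\mathbf{w};A_1,\dots,A_m)\,d\nu(\mathbf{w})$. The $m$-variable logarithmic mean $L_m$ is the geodesic mean obtained when $\nu$ is the uniform probability measure on $\Sigma_m$.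 *)

theory Defs
  imports "HOL-Probability.Probability"
begin

definition conj_transpose :: "complex^'n^'n \<Rightarrow> complex^'n^'n" where
  "conj_transpose A = transpose (map_matrix cnj A)"

definition hermitian :: "complex^'n^'n \<Rightarrow> bool" where
  "hermitian A \<longleftrightarrow> conj_transpose A = A"

definition unitary :: "complex^'n^'n \<Rightarrow> bool" where
  "unitary U \<longleftrightarrow> conj_transpose U ** U = mat 1 \<and> U ** conj_transpose U = mat 1"

definition quad_form :: "complex^'n^'n \<Rightarrow> complex^'n \<Rightarrow> complex" where
  "quad_form A x = (\<Sum>i\<in>UNIV. cnj (x $ i) * (A *v x) $ i)"

definition pos_def :: "complex^'n^'n \<Rightarrow> bool" where
  "pos_def A \<longleftrightarrow> hermitian A \<and> (\<forall>x. x \<noteq> 0 \<longrightarrow> 0 < Re (quad_form A x))"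

definition pos_semidef :: "complex^'n^'n \<Rightarrow> bool" where
  "pos_semidef A \<longleftrightarrow> hermitian A \<and> (\<forall>x. 0 \<le> Re (quad_form A x))"

(* A separate symbol: the library order on vectors is entrywise. *)
definition loewner_le :: "complex^'n^'n \<Rightarrow> complex^'n^'n \<Rightarrow> bool" (infix "\<preceq>\<^sub>L" 50) where
  "A \<preceq>\<^sub>L B \<longleftrightarrow> pos_semidef (B - A)"

definition diag_matrix :: "('n \<Rightarrow> complex) \<Rightarrow> complex^'n^'n" where
  "diag_matrix d = (\<chi> i j. if i = j then d i else 0)"

(* Functional calculus f(A) = U diag(f(d)) U* for Hermitian A = U diag(d) U*, with d real;
   the result does not depend on the chosen diagonalization. *)
definition herm_fun :: "(real \<Rightarrow> real) \<Rightarrow> complex^'n^'n \<Rightarrow> complex^'n^'n" where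
  "herm_fun f A = (THE B. \<exists>U d. unitary U \<and>
     A = U ** diag_matrix (\<lambda>i. of_real (d i)) ** conj_transpose U \<and>
     B = U ** diag_matrix (\<lambda>i. of_real (f (d i))) ** conj_transpose U)"

(* The norm of the type complex^'n^'n is the Euclidean norm of all entries,
   which is the Hilbert--Schmidt norm. *)
definition riem_dist :: "complex^'n^'n \<Rightarrow> complex^'n^'n \<Rightarrow> real" where
  "riem_dist A B =
     (let R = herm_fun (\<lambda>t. t powr (- 1 / 2)) A in norm (herm_fun ln (R ** B ** R)))"

(* Weight vectors are functions on {1..m}, extended by undefined outside that set. *)
definition prob_simplex :: "nat \<Rightarrow> (nat \<Rightarrow> real) set" where
  "prob_simplex m = {w \<in> {1..m} \<rightarrow>\<^sub>E {0..}. (\<Sum>i = 1..m. w i) = 1}"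

definition borel_simplex :: "nat \<Rightarrow> (nat \<Rightarrow> real) measure" where
  "borel_simplex m = restrict_space (\<Pi>\<^sub>M i\<in>{1..m}. borel) (prob_simplex m)"

definition geo_mean :: "nat \<Rightarrow> (nat \<Rightarrow> real) \<Rightarrow> (nat \<Rightarrow> complex^'n^'n) \<Rightarrow> complex^'n^'n" where
  "geo_mean m w A =
     (THE X. is_arg_min (\<lambda>X. \<Sum>i = 1..m. w i * (riem_dist X (A i))\<^sup>2) pos_def X)"

definition geodesic_mean ::
  "nat \<Rightarrow> (nat \<Rightarrow> real) measure \<Rightarrow> (nat \<Rightarrow> complex^'n^'n) \<Rightarrow> complex^'n^'n" where
  "geodesic_mean m \<nu> A = (LINT w|\<nu>. geo_mean m w A)"

(* Uniform distribution: normalized (m-1)-dimensional Lebesgue measure in the coordinates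
   w_1, ..., w_(m-1), with the last weight given by w_m = 1 - w_1 - ... - w_(m-1).
   It is meant for m \<ge> 1; for m = 1 it is the point mass at the only weight vector. *)
definition corner_simplex :: "nat \<Rightarrow> (nat \<Rightarrow> real) set" where
  "corner_simplex m = {u \<in> {1..<m} \<rightarrow>\<^sub>E {0..}. (\<Sum>i = 1..<m. u i) \<le> 1}"

definition uniform_simplex :: "nat \<Rightarrow> (nat \<Rightarrow> real) measure" where
  "uniform_simplex m =
     distr (uniform_measure (restrict_space (\<Pi>\<^sub>M i\<in>{1..<m}. lborel) (corner_simplex m))
                            (corner_simplex m))
           (borel_simplex m)
           (\<lambda>u. u(m := 1 - (\<Sum>i = 1..<m. u i)))"

definition log_mean :: "nat \<Rightarrow> (nat \<Rightarrow> complex^'n^'n) \<Rightarrow> complex^'n^'n" where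
  "log_mean m A = geodesic_mean m (uniform_simplex m) A"

end

theory Submission
  imports Defs "HOL-Real_Asymp.Real_Asymp"
begin

text \<open>
The weighted geometric mean \<open>X\<close> of \<open>A\<^sub>i\<close> is characterized by the equation
\<open>\<Sum> w\<^sub>i log (X\<^bsup>-1/2\<^esup> A\<^sub>i X\<^bsup>-1/2\<^esup>) = 0\<close>. Inserting the scalar inequalities
\<open>1 - 1/t \<le> ln t \<le> t - 1\<close> for the eigenvalues of \<open>X\<^bsup>-1/2\<^esup> A\<^sub>i X\<^bsup>-1/2\<^esup>\<close> gives at once
\<open>X \<le> \<Sum> w\<^sub>i A\<^sub>i\<close> and \<open>X\<^bsup>-1\<^esup> \<le> \<Sum> w\<^sub>i A\<^sub>i\<^bsup>-1\<^esup>\<close>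
(\<open>bary_le_arithmetic\<close>, \<open>bary_ge_harmonic_tangent\<close>). The upper bound is linear in the
weights and can be integrated as it stands. For the lower bound one uses that inversion is operator
convex, in the form of its tangent inequality at a fixed matrix: with
\<open>Z = (\<Sum> wbar\<^sub>i A\<^sub>i\<^bsup>-1\<^esup>)\<^bsup>-1\<^esup>\<close> one has
\<open>X \<ge> 2 Z - Z X\<^bsup>-1\<^esup> Z \<ge> 2 Z - Z (\<Sum> w\<^sub>i A\<^sub>i\<^bsup>-1\<^esup>) Z\<close>, and the integral of the right-hand
side is \<open>Z\<close> (\<open>geodesic_mean_bounds\<close>).

That the minimizer exists, is unique and satisfies the equation rests on one geometric fact, the
nonpositive curvature of the cone of positive definite matrices:
\<open>\<parallel>log X - log Y\<parallel> \<le> \<delta>(X, Y)\<close> (\<open>norm_hlog_diff_le_riem_dist\<close>). It is proved here without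
differentiating matrix functions. In eigenbases of \<open>X\<close> and \<open>Y\<close> the inequality
\<open>(ln x - ln y)\<^sup>2 \<le> x/y + y/x - 2\<close> gives
\<open>\<parallel>log X - log Y\<parallel>\<^sup>2 \<le> tr (X\<^bsup>-1\<^esup> Y + Y\<^bsup>-1\<^esup> X - 2)\<close>, and this chord estimate, applied to finer
and finer subdivisions of the geodesic from \<open>X\<close> to \<open>Y\<close>, converges to the claim.
Together with the invariance of \<open>\<delta>\<close> under congruences it yields the triangle inequality, the
strong convexity estimate \<open>cost_ge\<close>, uniqueness, the first order condition, and the
continuity of the mean in the weights that makes the integral meaningful.

For the logarithmic mean it remains to see that the uniform distribution has barycentre
\<open>(1/m, \<dots>, 1/m)\<close> (\<open>mean_weight_uniform\<close>).
\<close>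

section \<open>Complex matrices and the Hermitian product\<close>

notation conj_transpose ("_\<^sup>\<dagger>" [1000] 1000)

lemma conj_transpose_nth [simp]: "A\<^sup>\<dagger> $ i $ j = cnj (A $ j $ i)"
  by (simp add: conj_transpose_def transpose_def)

lemma conj_transpose_twice [simp]: "A\<^sup>\<dagger>\<^sup>\<dagger> = A"
  by (simp add: vec_eq_iff)

lemma conj_transpose_mult: "(A ** B)\<^sup>\<dagger> = B\<^sup>\<dagger> ** A\<^sup>\<dagger>"
  by (simp add: vec_eq_iff matrix_matrix_mult_def mult.commute)

lemma conj_transpose_add: "(A + B)\<^sup>\<dagger> = A\<^sup>\<dagger> + B\<^sup>\<dagger>"
  and conj_transpose_diff: "(A - B)\<^sup>\<dagger> = A\<^sup>\<dagger> - B\<^sup>\<dagger>"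
  and conj_transpose_scaleR: "(c *\<^sub>R A)\<^sup>\<dagger> = c *\<^sub>R A\<^sup>\<dagger>"
  and conj_transpose_one [simp]: "(mat 1)\<^sup>\<dagger> = mat 1"
  by (simp_all add: vec_eq_iff mat_def)

lemma bounded_linear_conj_transpose: "bounded_linear (conj_transpose :: complex^'n^'n \<Rightarrow> _)"
  by (rule linear_conv_bounded_linear[THEN iffD1], rule linearI)
     (simp_all add: conj_transpose_add conj_transpose_scaleR)

lemma scaleR_mult_left: "(c *\<^sub>R A) ** B = c *\<^sub>R (A ** (B :: complex^'n^'n))"
  and scaleR_mult_right: "A ** (c *\<^sub>R B) = c *\<^sub>R (A ** (B :: complex^'n^'n))"
  by (simp_all add: vec_eq_iff matrix_matrix_mult_def scaleR_sum_right)

lemma mult_add_left: "(A + B) ** C = A ** C + B ** (C :: complex^'n^'n)"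
  and mult_diff_left: "(A - B) ** C = A ** C - B ** (C :: complex^'n^'n)"
  and mult_diff_right: "C ** (A - B) = C ** A - C ** (B :: complex^'n^'n)"
  by (simp_all add: vec_eq_iff matrix_matrix_mult_def algebra_simps sum.distrib sum_subtractf)

lemma bounded_linear_sandwich:
  fixes A B :: "complex^'n^'n"
  shows "bounded_linear (\<lambda>X. A ** X ** B)"
  by (rule linear_conv_bounded_linear[THEN iffD1], rule linearI)
     (simp_all add: matrix_add_ldistrib mult_add_left scaleR_mult_left scaleR_mult_right)

lemma sandwich_sum:
  fixes A B :: "complex^'n^'n"
  shows "A ** (\<Sum>i\<in>I. f i) ** B = (\<Sum>i\<in>I. A ** f i ** B)"
  by (rule linear_sum[OF bounded_linear.linear[OF bounded_linear_sandwich]])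

text \<open>Complex orthogonality of eigenvectors needs the full Hermitian product; the inner product
of the type, regarded as a real vector space, is its real part.\<close>

definition hinner :: "complex^'n \<Rightarrow> complex^'n \<Rightarrow> complex" where
  "hinner x y = (\<Sum>i\<in>UNIV. cnj (x $ i) * y $ i)"

lemma Re_hinner: "Re (hinner x y) = x \<bullet> y"
  by (simp add: hinner_def inner_vec_def inner_complex_def)

lemma hinner_self: "hinner x x = of_real (x \<bullet> x)"
  by (simp add: hinner_def inner_vec_def inner_complex_def complex_eq_iff)

lemma hinner_add_right: "hinner x (y + z) = hinner x y + hinner x z"
  and hinner_scaleR_left: "hinner (c *\<^sub>R x) y = c *\<^sub>R hinner x y"
  and hinner_scaleR_right: "hinner x (c *\<^sub>R y) = c *\<^sub>R hinner x y"
  by (simp_all add: hinner_def algebra_simps sum.distrib scaleR_sum_right)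

lemma hinner_commute: "hinner y x = cnj (hinner x y)"
  by (simp add: hinner_def mult.commute)

lemma hinner_adjoint: "hinner x (A *v y) = hinner (A\<^sup>\<dagger> *v x) y"
proof -
  have "hinner x (A *v y) = (\<Sum>i\<in>UNIV. \<Sum>j\<in>UNIV. cnj (x $ i) * A $ i $ j * y $ j)"
    by (simp add: hinner_def matrix_vector_mult_def sum_distrib_left mult.assoc)
  also have "\<dots> = (\<Sum>j\<in>UNIV. \<Sum>i\<in>UNIV. cnj (x $ i) * A $ i $ j * y $ j)"
    by (rule sum.swap)
  also have "\<dots> = hinner (A\<^sup>\<dagger> *v x) y"
    by (simp add: hinner_def matrix_vector_mult_def sum_distrib_left mult_ac)
  finally show ?thesis .
qed

lemma quad_form_hinner: "quad_form A x = hinner x (A *v x)"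
  by (simp add: quad_form_def hinner_def)

lemma quad_form_sandwich: "quad_form (B ** A ** B\<^sup>\<dagger>) x = quad_form A (B\<^sup>\<dagger> *v x)"
  by (simp add: quad_form_hinner hinner_adjoint[of x B] flip: matrix_vector_mul_assoc)

section \<open>The spectral theorem\<close>

text \<open>Let \<open>c\<close> be the maximum of \<open>v \<bullet> f v\<close> on the unit sphere of \<open>W\<close>. The form
\<open>q x = c (x \<bullet> x) - x \<bullet> f x\<close> is nonnegative on \<open>W\<close> and vanishes at the maximizer \<open>v\<close>; a nonnegative
form vanishes at a vector only if its operator does, so \<open>c v - f v = 0\<close>.\<close>

lemma symmetric_operator_eigenvector:
  fixes f :: "'a::euclidean_space \<Rightarrow> 'a"
  assumes lin: "linear f" and sym: "\<And>x y. f x \<bullet> y = x \<bullet> f y"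
    and W: "subspace W" "\<And>x. x \<in> W \<Longrightarrow> f x \<in> W" and x0: "x0 \<in> W" "x0 \<noteq> 0"
  shows "\<exists>v c. v \<in> W \<and> v \<bullet> v = 1 \<and> f v = c *\<^sub>R v"
proof -
  interpret f: linear f by (rule lin)
  have "compact (W \<inter> sphere 0 1)"
    by (intro closed_Int_compact closed_subspace W compact_sphere)
  moreover have "(1 / norm x0) *\<^sub>R x0 \<in> W \<inter> sphere 0 1"
    using W x0 by (auto intro: subspace_scale)
  moreover have "continuous_on (W \<inter> sphere 0 1) (\<lambda>x. x \<bullet> f x)"
    by (intro continuous_intros linear_continuous_on linear_conv_bounded_linear[THEN iffD1] lin)
  ultimately obtain v where v: "v \<in> W \<inter> sphere 0 1"
    and vmax: "\<And>y. y \<in> W \<inter> sphere 0 1 \<Longrightarrow> y \<bullet> f y \<le> v \<bullet> f v"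
    by (metis continuous_attains_sup empty_iff)
  define c where "c = v \<bullet> f v"
  have vv: "v \<bullet> v = 1" using v by (simp add: norm_eq_sqrt_inner)
  define q where "q x = c * (x \<bullet> x) - x \<bullet> f x" for x
  have q_nonneg: "q x \<ge> 0" if "x \<in> W" for x
  proof (cases "x = 0")
    case False
    have "(1 / norm x) *\<^sub>R x \<in> W \<inter> sphere 0 1"
      using W that False by (auto intro: subspace_scale)
    from vmax[OF this] have "(x \<bullet> f x) / (norm x)\<^sup>2 \<le> c"
      by (simp add: f.scaleR c_def power2_eq_square)
    then show ?thesis
      using False by (simp add: q_def field_simps power2_norm_eq_inner)
  qed (simp add: q_def)
  define b where "b = c *\<^sub>R v - f v"
  have bW: "b \<in> W" using v W by (auto simp: b_def intro: subspace_diff subspace_scale)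
  have expand: "q (v + t *\<^sub>R b) = 2 * t * (b \<bullet> b) + t\<^sup>2 * q b" for t
  proof -
    have "q (v + t *\<^sub>R b) = q v + 2 * t * (b \<bullet> (c *\<^sub>R v - f v)) + t\<^sup>2 * q b"
      using sym[of v b] by (simp add: q_def f.add f.scaleR inner_simps power2_eq_square
          algebra_simps inner_commute)
    also have "q v = 0" by (simp add: q_def vv c_def)
    finally show ?thesis by (simp add: b_def)
  qed
  have "b \<bullet> b = 0"
  proof (rule ccontr)
    assume "b \<bullet> b \<noteq> 0"
    then have pos: "b \<bullet> b > 0" by simp
    \<comment> \<open>A step length so short that the first order term decides the sign: \<open>q\<close> would be negative at \<open>v - s b\<close>.\<close>
    define s where "s = (b \<bullet> b) / (q b + 1)"
    have qb: "q b \<ge> 0" using q_nonneg bW .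
    then have s: "s > 0" "s * q b \<le> b \<bullet> b" using pos by (auto simp: s_def field_simps)
    have "0 \<le> q (v + (- s) *\<^sub>R b)"
      using W v bW by (intro q_nonneg) (auto intro!: subspace_diff subspace_scale)
    also have "\<dots> = s * (s * q b - 2 * (b \<bullet> b))"
      by (subst expand) (simp add: power2_eq_square algebra_simps)
    finally show False using s pos by (simp add: zero_le_mult_iff)
  qed
  then have "f v = c *\<^sub>R v" by (simp add: b_def)
  with v vv show ?thesis by auto
qed

text \<open>The map that sends \<open>x\<close> to its products with the vectors \<open>v j\<close>, filled up with zeros outside \<open>J\<close>,
misses the \<open>k\<close>-th coordinate vector. An endomorphism that is not surjective has a kernel.\<close>

lemma exists_orthogonal_vector:
  fixes v :: "'n \<Rightarrow> complex^'n"
  assumes "k \<notin> J"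
  shows "\<exists>x. x \<noteq> 0 \<and> (\<forall>j\<in>J. hinner (v j) x = 0)"
proof (rule ccontr)
  assume *: "\<not> ?thesis"
  define F :: "complex^'n \<Rightarrow> complex^'n" where
    "F x = (\<chi> j. if j \<in> J then hinner (v j) x else 0)" for x
  have lin: "linear F"
    by (rule linearI) (auto simp: F_def vec_eq_iff hinner_add_right hinner_scaleR_right)
  have "x = 0" if "F x = 0" for x
  proof -
    have "hinner (v j) x = 0" if "j \<in> J" for j
      using \<open>F x = 0\<close> that by (auto simp: F_def vec_eq_iff split: if_splits)
    with * show ?thesis by blast
  qed
  then have "surj F"
    using lin by (intro linear_injective_imp_surjective) (auto simp: linear_injective_0)
  then obtain x where "F x = axis k 1" by (metis surjD)
  then have "F x $ k = 1" by simp
  with assms show False by (simp add: F_def)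
qed

text \<open>Eigenvectors are found one index at a time: the orthogonal complement of those already chosen
is invariant under \<open>A\<close>, and it is not zero as long as an index is left. Indexing by the
coordinates themselves makes the eigenvectors the columns of a square matrix at the end.\<close>

lemma hermitian_eigenvectors:
  fixes A :: "complex^'n^'n"
  assumes A: "hermitian A" and "finite J"
  shows "\<exists>(v :: 'n \<Rightarrow> complex^'n) (d :: 'n \<Rightarrow> real). (\<forall>i\<in>J. A *v v i = d i *\<^sub>R v i) \<and>
    (\<forall>i\<in>J. \<forall>j\<in>J. hinner (v i) (v j) = (if i = j then 1 else 0))"
  using \<open>finite J\<close>
proof induction
  case empty
  then show ?case by auto
next
  case (insert k J)
  then obtain v d where eig: "\<And>i. i \<in> J \<Longrightarrow> A *v v i = d i *\<^sub>R v i"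
    and orth: "\<And>i j. i \<in> J \<Longrightarrow> j \<in> J \<Longrightarrow> hinner (v i) (v j) = (if i = j then 1 else 0)"
    by blast
  define W where "W = {x. \<forall>j\<in>J. hinner (v j) x = 0}"
  have symc: "hinner x (A *v y) = hinner (A *v x) y" for x y
    using hinner_adjoint[of x A y] A by (simp add: hermitian_def)
  obtain x0 where x0: "x0 \<noteq> 0" "x0 \<in> W"
    using exists_orthogonal_vector[OF insert.hyps(2), of v] unfolding W_def by blast
  have "\<exists>w c. w \<in> W \<and> w \<bullet> w = 1 \<and> A *v w = c *\<^sub>R w"
  proof (rule symmetric_operator_eigenvector[where f = "(*v) A"])
    show "linear ((*v) A)" by (simp add: matrix_vector_mul_linear)
    show "(A *v x) \<bullet> y = x \<bullet> (A *v y)" for x y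
      using arg_cong[OF symc, of Re x y] by (simp add: Re_hinner)
    show "subspace W"
      unfolding subspace_def W_def
      by (auto simp: hinner_add_right hinner_scaleR_right) (simp add: hinner_def)
    show "A *v x \<in> W" if "x \<in> W" for x
      using that by (auto simp: W_def symc eig hinner_scaleR_left)
  qed (use x0 in auto)
  then obtain w c where w: "w \<in> W" "w \<bullet> w = 1" "A *v w = c *\<^sub>R w" by blast
  have wv: "hinner (v j) w = 0" "hinner w (v j) = 0" if "j \<in> J" for j
    using w that hinner_commute[of w "v j"] by (auto simp: W_def)
  define v' where "v' = v(k := w)"
  define d' where "d' = d(k := c)"
  have old: "v' j = v j" "d' j = d j" if "j \<in> J" for j
    using that insert.hyps(2) by (auto simp: v'_def d'_def)
  have new: "v' k = w" "d' k = c" by (auto simp: v'_def d'_def)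
  have "A *v v' i = d' i *\<^sub>R v' i" if "i \<in> insert k J" for i
    using that w(3) eig by (cases "i = k") (simp_all add: old new)
  moreover have "hinner (v' i) (v' j) = (if i = j then 1 else 0)"
    if "i \<in> insert k J" "j \<in> insert k J" for i j
    using that insert.hyps(2) w(2) orth wv
    by (cases "i = k"; cases "j = k") (simp_all add: old new hinner_self)
  ultimately show ?case by blast
qed

definition udiag :: "complex^'n^'n \<Rightarrow> ('n \<Rightarrow> real) \<Rightarrow> complex^'n^'n" where
  "udiag U d = U ** diag_matrix (\<lambda>i. of_real (d i)) ** U\<^sup>\<dagger>"

lemma unitaryD: "unitary U \<Longrightarrow> U\<^sup>\<dagger> ** U = mat 1" "unitary U \<Longrightarrow> U ** U\<^sup>\<dagger> = mat 1"
  by (auto simp: unitary_def)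

lemma unitary_conj_transpose: "unitary U \<Longrightarrow> unitary (U\<^sup>\<dagger>)"
  by (simp add: unitary_def)

lemma unitary_one: "unitary (mat 1 :: complex^'n^'n)"
  by (simp add: unitary_def)

lemma unitaryI: "U\<^sup>\<dagger> ** U = mat 1 \<Longrightarrow> unitary U"
  unfolding unitary_def using matrix_left_right_inverse by blast

lemma mult_diag_nth [simp]: "(A ** diag_matrix d) $ i $ j = A $ i $ j * d j"
  by (simp add: matrix_matrix_mult_def diag_matrix_def if_distrib cong: if_cong)

lemma diag_mult_nth [simp]: "(diag_matrix d ** A) $ i $ j = d i * A $ i $ j"
  by (simp add: matrix_matrix_mult_def diag_matrix_def if_distrib if_distribR cong: if_cong)

theorem hermitian_diagonalizable:
  fixes A :: "complex^'n^'n"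
  assumes "hermitian A"
  obtains U d where "unitary U" "A = udiag U d"
proof -
  obtain v :: "'n \<Rightarrow> complex^'n" and d where eig: "\<And>i. A *v v i = d i *\<^sub>R v i"
    and orth: "\<And>i j. hinner (v i) (v j) = (if i = j then 1 else 0)"
    using hermitian_eigenvectors[OF assms finite_class.finite_UNIV] by auto
  define U where "U = (\<chi> i j. v j $ i)"
  have "U\<^sup>\<dagger> ** U = mat 1"
    using orth by (simp add: vec_eq_iff matrix_matrix_mult_def U_def mat_def hinner_def)
  then have U: "unitary U" by (rule unitaryI)
  have "A ** U = U ** diag_matrix (\<lambda>i. of_real (d i))"
  proof (intro vec_eq_iff[THEN iffD2] allI)
    fix i j
    have "(A ** U) $ i $ j = (A *v v j) $ i"
      by (simp add: matrix_matrix_mult_def matrix_vector_mult_def U_def)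
    then show "(A ** U) $ i $ j = (U ** diag_matrix (\<lambda>i. of_real (d i))) $ i $ j"
      by (simp add: eig) (simp add: U_def scaleR_conv_of_real mult.commute)
  qed
  then have "A ** (U ** U\<^sup>\<dagger>) = udiag U d"
    by (simp add: udiag_def matrix_mul_assoc)
  then show ?thesis using U that by (simp add: unitaryD)
qed

section \<open>Functional calculus in a diagonalizing frame\<close>

lemma udiag_nth: "udiag U d $ i $ j = (\<Sum>k\<in>UNIV. U $ i $ k * of_real (d k) * cnj (U $ j $ k))"
  by (simp add: udiag_def matrix_matrix_mult_def[of _ "U\<^sup>\<dagger>"])

lemma udiag_sandwich: "W ** udiag U d ** W\<^sup>\<dagger> = udiag (W ** U) d"
  by (simp add: udiag_def conj_transpose_mult matrix_mul_assoc)

lemma udiag_mult: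
  assumes "unitary U"
  shows "udiag U d ** udiag U e = udiag U (\<lambda>i. d i * e i)"
proof -
  have "udiag U d ** udiag U e = U ** diag_matrix (\<lambda>i. of_real (d i)) ** (U\<^sup>\<dagger> ** U)
      ** diag_matrix (\<lambda>i. of_real (e i)) ** U\<^sup>\<dagger>"
    by (simp add: udiag_def matrix_mul_assoc)
  also have "\<dots> = U ** (diag_matrix (\<lambda>i. of_real (d i)) ** diag_matrix (\<lambda>i. of_real (e i))) ** U\<^sup>\<dagger>"
    by (simp add: unitaryD[OF assms] matrix_mul_assoc)
  also have "diag_matrix (\<lambda>i. complex_of_real (d i)) ** diag_matrix (\<lambda>i. of_real (e i))
      = diag_matrix (\<lambda>i. of_real (d i * e i))"
    by (subst vec_eq_iff) (auto simp: vec_eq_iff diag_matrix_def[of "\<lambda>i. of_real (d i)"] diag_matrix_def[of "\<lambda>i. of_real (d i) * of_real (e i)"])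
  finally show ?thesis by (simp add: udiag_def)
qed

lemma udiag_add: "udiag U d + udiag U e = udiag U (\<lambda>i. d i + e i)"
  and udiag_diff: "udiag U d - udiag U e = udiag U (\<lambda>i. d i - e i)"
  and udiag_scaleR: "c *\<^sub>R udiag U d = udiag U (\<lambda>i. c * d i)"
  by (simp_all add: vec_eq_iff udiag_nth algebra_simps sum.distrib sum_subtractf scaleR_sum_right)
     (simp add: scaleR_conv_of_real mult_ac)

lemma udiag_const:
  fixes U :: "complex^'n^'n"
  assumes U: "unitary U"
  shows "udiag U (\<lambda>_. c) = c *\<^sub>R mat 1"
proof -
  have "(diag_matrix (\<lambda>_. 1) :: complex^'n^'n) = mat 1" by (simp add: diag_matrix_def mat_def)
  then have "udiag U (\<lambda>_. 1) = mat 1" by (simp add: udiag_def unitaryD[OF U])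
  then show ?thesis using udiag_scaleR[of c U "\<lambda>_. 1"] by simp
qed

lemma conj_transpose_udiag [simp]: "(udiag U d)\<^sup>\<dagger> = udiag U d"
  by (simp add: vec_eq_iff udiag_nth mult_ac)

lemma Re_quad_form_udiag:
  "Re (quad_form (udiag U d) x) = (\<Sum>i\<in>UNIV. d i * (norm ((U\<^sup>\<dagger> *v x) $ i))\<^sup>2)"
proof -
  have "quad_form (udiag U d) x = quad_form (diag_matrix (\<lambda>i. of_real (d i))) (U\<^sup>\<dagger> *v x)"
    by (simp add: udiag_def quad_form_sandwich)
  moreover have "(diag_matrix (\<lambda>i. of_real (d i)) *v y) $ i = of_real (d i) * y $ i" for i and y :: "complex^'a"
    by (simp add: diag_matrix_def matrix_vector_mult_def if_distrib if_distribR cong: if_cong)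
  ultimately have "quad_form (udiag U d) x
      = (\<Sum>i\<in>UNIV. of_real (d i) * (cnj ((U\<^sup>\<dagger> *v x) $ i) * (U\<^sup>\<dagger> *v x) $ i))"
    by (simp add: quad_form_def mult_ac)
  also have "\<dots> = (\<Sum>i\<in>UNIV. of_real (d i * (norm ((U\<^sup>\<dagger> *v x) $ i))\<^sup>2))"
    by (intro sum.cong refl) (simp only: of_real_mult complex_norm_square mult.commute[of "cnj _"])
  finally show ?thesis by simp
qed

lemma Re_quad_form_udiag_column:
  assumes "unitary U"
  shows "Re (quad_form (udiag U d) (U *v axis k 1)) = d k"
  by (simp add: Re_quad_form_udiag matrix_vector_mul_assoc unitaryD[OF assms] axis_def
      if_distrib[of norm] if_distrib[of "\<lambda>x. x\<^sup>2"] if_distrib[of "\<lambda>x. _ * x"] cong: if_cong)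

lemma pos_semidef_udiag:
  assumes "unitary U"
  shows "pos_semidef (udiag U d) \<longleftrightarrow> (\<forall>i. 0 \<le> d i)"
proof
  show "\<forall>i. 0 \<le> d i" if "pos_semidef (udiag U d)"
    using that Re_quad_form_udiag_column[OF assms] by (metis pos_semidef_def)
  show "pos_semidef (udiag U d)" if "\<forall>i. 0 \<le> d i"
    using that by (auto simp: pos_semidef_def hermitian_def Re_quad_form_udiag intro!: sum_nonneg)
qed

lemma invertible_mult_eq_0:
  fixes S T :: "complex^'n^'n"
  assumes "S ** T = mat 1" "T *v x = 0"
  shows "x = 0"
  by (metis assms matrix_vector_mul_assoc matrix_vector_mul_lid matrix_vector_mult_0_right)

lemma pos_def_udiag:
  assumes "unitary U"
  shows "pos_def (udiag U d) \<longleftrightarrow> (\<forall>i. 0 < d i)"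
proof
  show "\<forall>i. 0 < d i" if "pos_def (udiag U d)"
  proof
    fix i
    have "U *v axis i 1 \<noteq> 0"
      using invertible_mult_eq_0[OF unitaryD(1)[OF assms], of "axis i 1"] by (auto simp: axis_eq_0_iff)
    then show "0 < d i"
      using that Re_quad_form_udiag_column[OF assms] by (metis pos_def_def)
  qed
  show "pos_def (udiag U d)" if d: "\<forall>i. 0 < d i"
    unfolding pos_def_def
  proof (intro conjI allI impI)
    fix x :: "complex^'a"
    assume "x \<noteq> 0"
    then have "U\<^sup>\<dagger> *v x \<noteq> 0" using invertible_mult_eq_0[OF unitaryD(2)[OF assms]] by blast
    then obtain i where "(U\<^sup>\<dagger> *v x) $ i \<noteq> 0" by (auto simp: vec_eq_iff)
    then have "0 < d i * (norm ((U\<^sup>\<dagger> *v x) $ i))\<^sup>2" using d by simp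
    then show "0 < Re (quad_form (udiag U d) x)"
      unfolding Re_quad_form_udiag using d by (intro sum_pos2[of _ i]) (auto simp: less_imp_le)
  qed (simp add: hermitian_def)
qed

lemma pos_def_diagonalizable:
  assumes "pos_def A"
  obtains U d where "unitary U" "A = udiag U d" "\<And>i. 0 < d i"
  by (metis assms hermitian_diagonalizable pos_def_def pos_def_udiag)

text \<open>Two Hermitian matrices see each other only through the squared moduli of the overlaps
\<open>U\<^sup>\<dagger> ** V\<close> of their eigenbases. These are nonnegative weights, so a trace inequality follows from
the corresponding scalar inequality for pairs of eigenvalues.\<close>

lemma Re_trace_udiag_mult:
  "Re (trace (udiag U a ** udiag V b))
     = (\<Sum>i\<in>UNIV. \<Sum>j\<in>UNIV. a i * b j * (norm ((U\<^sup>\<dagger> ** V) $ i $ j))\<^sup>2)"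
proof -
  define W where "W = U\<^sup>\<dagger> ** V"
  have W: "W\<^sup>\<dagger> = V\<^sup>\<dagger> ** U" by (simp add: W_def conj_transpose_mult)
  have "trace (udiag U a ** udiag V b)
      = trace (U ** (diag_matrix (\<lambda>i. of_real (a i)) ** W ** diag_matrix (\<lambda>i. of_real (b i)) ** V\<^sup>\<dagger>))"
    by (simp add: udiag_def W_def matrix_mul_assoc)
  also have "\<dots> = trace (diag_matrix (\<lambda>i. of_real (a i)) ** (W ** diag_matrix (\<lambda>i. of_real (b i)) ** W\<^sup>\<dagger>))"
    by (subst trace_mul_sym) (simp add: W matrix_mul_assoc)
  also have "\<dots> = (\<Sum>i\<in>UNIV. of_real (a i) * (\<Sum>j\<in>UNIV. W $ i $ j * of_real (b j) * cnj (W $ i $ j)))"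
    by (simp add: trace_def udiag_nth flip: udiag_def)
  also have "\<dots> = (\<Sum>i\<in>UNIV. \<Sum>j\<in>UNIV. of_real (a i * b j) * (W $ i $ j * cnj (W $ i $ j)))"
    by (simp add: sum_distrib_left mult_ac)
  also have "\<dots> = (\<Sum>i\<in>UNIV. \<Sum>j\<in>UNIV. of_real (a i * b j * (norm (W $ i $ j))\<^sup>2))"
    by (intro sum.cong refl) (simp only: of_real_mult complex_norm_square)
  finally show ?thesis by (simp add: W_def)
qed

lemma inner_matrix_trace: "A \<bullet> B = Re (trace (A\<^sup>\<dagger> ** (B :: complex^'n^'n)))"
proof -
  have "A \<bullet> B = (\<Sum>i\<in>UNIV. \<Sum>j\<in>UNIV. Re (cnj (A $ i $ j) * B $ i $ j))"
    by (simp add: inner_vec_def inner_complex_def)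
  also have "\<dots> = Re (trace (A\<^sup>\<dagger> ** B))"
    by (subst sum.swap) (simp add: trace_def matrix_matrix_mult_def)
  finally show ?thesis .
qed

text \<open>All three terms of the expanded square are brought into the form of the overlap formula by
writing the identity matrix as a diagonal matrix in the other eigenbasis.\<close>

lemma norm_udiag_diff_sq:
  assumes U: "unitary U" and V: "unitary V"
  shows "(norm (udiag U x - udiag V y))\<^sup>2
    = (\<Sum>i\<in>UNIV. \<Sum>j\<in>UNIV. (x i - y j)\<^sup>2 * (norm ((U\<^sup>\<dagger> ** V) $ i $ j))\<^sup>2)"
proof -
  have one: "udiag U (\<lambda>_. 1) = mat 1" "udiag V (\<lambda>_. 1) = mat 1"
    using assms by (simp_all add: udiag_const)
  have xx: "udiag U x \<bullet> udiag U x = Re (trace (udiag U (\<lambda>i. x i * x i) ** udiag V (\<lambda>_. 1)))"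
    by (simp add: inner_matrix_trace udiag_mult[OF U] one)
  have yy: "udiag V y \<bullet> udiag V y = Re (trace (udiag U (\<lambda>_. 1) ** udiag V (\<lambda>i. y i * y i)))"
    by (simp add: inner_matrix_trace udiag_mult[OF V] one)
  have xy: "udiag U x \<bullet> udiag V y = Re (trace (udiag U x ** udiag V y))"
    by (simp add: inner_matrix_trace)
  have "(norm (udiag U x - udiag V y))\<^sup>2
      = udiag U x \<bullet> udiag U x + udiag V y \<bullet> udiag V y - 2 * (udiag U x \<bullet> udiag V y)"
    by (simp add: power2_norm_eq_inner inner_diff_left inner_diff_right inner_commute)
  then show ?thesis
    unfolding xx yy xy Re_trace_udiag_mult
    by (simp add: power2_eq_square algebra_simps sum.distrib sum_subtractf flip: sum_distrib_left)
       (simp add: sum_distrib_left mult_ac)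
qed

lemma norm_udiag_sq:
  assumes U: "unitary U"
  shows "(norm (udiag U x))\<^sup>2 = (\<Sum>i\<in>UNIV. (x i)\<^sup>2)"
  using norm_udiag_diff_sq[OF U U, of x "\<lambda>_. 0"]
  by (simp add: unitaryD[OF U] udiag_const[OF U] mat_def if_distrib[of norm] if_distrib[of "\<lambda>x. x\<^sup>2"]
      if_distrib[of "\<lambda>x. _ * x"] cong: if_cong)

text \<open>The functional calculus does not depend on the diagonalization: if two of them represent the
same matrix, then eigenvectors of different eigenvalues have overlap zero, so every term of the
overlap sum still vanishes after \<open>f\<close> has been applied to the eigenvalues.\<close>

lemma herm_fun_udiag:
  assumes U: "unitary U"
  shows "herm_fun f (udiag U d) = udiag U (\<lambda>i. f (d i))"
  unfolding herm_fun_def udiag_def[symmetric]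
proof (rule the_equality)
  fix B assume "\<exists>V e. unitary V \<and> udiag U d = udiag V e \<and> B = udiag V (\<lambda>i. f (e i))"
  then obtain V e where V: "unitary V" and eq: "udiag U d = udiag V e" and B: "B = udiag V (\<lambda>i. f (e i))"
    by blast
  have "(\<Sum>i\<in>UNIV. \<Sum>j\<in>UNIV. (d i - e j)\<^sup>2 * (norm ((U\<^sup>\<dagger> ** V) $ i $ j))\<^sup>2) = 0"
    using norm_udiag_diff_sq[OF U V, of d e] eq by simp
  then have "(d i - e j)\<^sup>2 * (norm ((U\<^sup>\<dagger> ** V) $ i $ j))\<^sup>2 = 0" for i j
    by (simp add: sum_nonneg_eq_0_iff sum_nonneg)
  then have zero: "d i = e j \<or> (U\<^sup>\<dagger> ** V) $ i $ j = 0" for i j by auto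
  have "(f (d i) - f (e j))\<^sup>2 * (norm ((U\<^sup>\<dagger> ** V) $ i $ j))\<^sup>2 = 0" for i j
    using zero[of i j] by auto
  then have "(norm (udiag U (\<lambda>i. f (d i)) - B))\<^sup>2 = 0"
    unfolding B norm_udiag_diff_sq[OF U V] by (simp only: sum.neutral_const)
  then show "B = udiag U (\<lambda>i. f (d i))" by simp
qed (use U in blast)

lemma unitary_mult:
  assumes "unitary V" "unitary W"
  shows "unitary (V ** W)"
proof (rule unitaryI)
  have "(V ** W)\<^sup>\<dagger> ** (V ** W) = W\<^sup>\<dagger> ** (V\<^sup>\<dagger> ** V) ** W"
    by (simp add: conj_transpose_mult matrix_mul_assoc)
  then show "(V ** W)\<^sup>\<dagger> ** (V ** W) = mat 1" by (simp add: unitaryD assms)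
qed

lemma herm_fun_unitary_sandwich:
  assumes W: "unitary W" and A: "hermitian A"
  shows "herm_fun f (W ** A ** W\<^sup>\<dagger>) = W ** herm_fun f A ** W\<^sup>\<dagger>"
proof -
  obtain U d where U: "unitary U" and A: "A = udiag U d" by (rule hermitian_diagonalizable[OF A])
  have "unitary (W ** U)" by (rule unitary_mult[OF W U])
  then show ?thesis by (simp add: A udiag_sandwich herm_fun_udiag U)
qed

lemma norm_unitary_sandwich:
  assumes "unitary W"
  shows "norm (W ** A ** W\<^sup>\<dagger>) = norm A"
proof -
  have "(W ** A ** W\<^sup>\<dagger>)\<^sup>\<dagger> ** (W ** A ** W\<^sup>\<dagger>) = W ** (A\<^sup>\<dagger> ** (W\<^sup>\<dagger> ** W) ** A ** W\<^sup>\<dagger>)"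
    by (simp add: conj_transpose_mult matrix_mul_assoc)
  also have "\<dots> = W ** (A\<^sup>\<dagger> ** A ** W\<^sup>\<dagger>)"
    by (simp add: unitaryD[OF assms])
  also have "trace \<dots> = trace (A\<^sup>\<dagger> ** A ** W\<^sup>\<dagger> ** W)"
    by (rule trace_mul_sym)
  also have "A\<^sup>\<dagger> ** A ** W\<^sup>\<dagger> ** W = A\<^sup>\<dagger> ** A ** (W\<^sup>\<dagger> ** W)"
    by (simp add: matrix_mul_assoc)
  also have "\<dots> = A\<^sup>\<dagger> ** A"
    by (simp add: unitaryD[OF assms])
  finally show ?thesis by (simp add: norm_eq_sqrt_inner inner_matrix_trace)
qed

lemma hermitian_sandwich: "hermitian A \<Longrightarrow> hermitian (S ** A ** S\<^sup>\<dagger>)"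
  by (simp add: hermitian_def conj_transpose_mult matrix_mul_assoc)

lemma pos_semidef_sandwich: "pos_semidef A \<Longrightarrow> pos_semidef (S ** A ** S\<^sup>\<dagger>)"
  by (simp add: pos_semidef_def hermitian_sandwich quad_form_sandwich)

lemma pos_def_sandwich:
  assumes "pos_def A" "S ** T = mat 1"
  shows "pos_def (S ** A ** S\<^sup>\<dagger>)"
proof -
  have "T\<^sup>\<dagger> ** S\<^sup>\<dagger> = mat 1"
    using arg_cong[OF assms(2), of conj_transpose] by (simp add: conj_transpose_mult)
  then show ?thesis
    using assms(1) invertible_mult_eq_0[of "T\<^sup>\<dagger>" "S\<^sup>\<dagger>"]
    by (auto simp: pos_def_def hermitian_sandwich quad_form_sandwich)
qed

section \<open>The Riemannian distance\<close>

abbreviation "hlog \<equiv> herm_fun ln"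

definition inv_sqrt :: "complex^'n^'n \<Rightarrow> complex^'n^'n" where
  "inv_sqrt = herm_fun (\<lambda>t. t powr (- 1 / 2))"

lemma riem_dist_eq: "riem_dist A B = norm (hlog (inv_sqrt A ** B ** inv_sqrt A))"
  by (simp add: riem_dist_def inv_sqrt_def Let_def)

text \<open>The congruence by \<open>inv_sqrt X\<close> moves \<open>X\<close> to the identity and the one by its inverse, the square
root \<open>C\<close>, moves back. This is how statements about an arbitrary centre are reduced to the identity.\<close>

lemma pos_def_sqrt:
  assumes "pos_def X"
  obtains C where "C\<^sup>\<dagger> = C" "(inv_sqrt X)\<^sup>\<dagger> = inv_sqrt X" "C ** C = X"
    "C ** inv_sqrt X = mat 1" "inv_sqrt X ** C = mat 1" "inv_sqrt X ** X ** inv_sqrt X = mat 1"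
proof -
  obtain U d where U: "unitary U" and X: "X = udiag U d" and d: "\<And>i. 0 < d i"
    using pos_def_diagonalizable[OF assms] by blast
  have R: "inv_sqrt X = udiag U (\<lambda>i. d i powr (- 1 / 2))"
    by (simp only: inv_sqrt_def X herm_fun_udiag[OF U])
  have half: "sqrt (d i) * d i powr (- 1 / 2) = 1" "d i powr (- 1 / 2) * sqrt (d i) = 1" for i
    using d[of i] by (simp_all add: powr_half_sqrt[symmetric] flip: powr_add)
  have CC: "udiag U (\<lambda>i. sqrt (d i)) ** udiag U (\<lambda>i. sqrt (d i)) = X"
    using d by (simp add: udiag_mult[OF U] X less_imp_le)
  have CR: "udiag U (\<lambda>i. sqrt (d i)) ** inv_sqrt X = mat 1"
    and RC: "inv_sqrt X ** udiag U (\<lambda>i. sqrt (d i)) = mat 1"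
    unfolding R udiag_mult[OF U] half by (simp_all add: udiag_const[OF U])
  have "inv_sqrt X ** X ** inv_sqrt X = mat 1"
    by (metis CC CR RC matrix_mul_assoc matrix_mul_rid)
  with CC CR RC show ?thesis
    by (intro that[of "udiag U (\<lambda>i. sqrt (d i))"]) (simp_all add: R)
qed

text \<open>With \<open>s = ln x - ln y\<close> the right-hand side is \<open>(2 sinh (s/2))\<^sup>2\<close>.\<close>

lemma ln_diff_sq_le:
  assumes "0 < x" "0 < (y :: real)"
  shows "(ln x - ln y)\<^sup>2 \<le> x / y + y / x - 2"
proof -
  define s where "s = ln x - ln y"
  define u where "u = \<bar>s\<bar> / 2"
  have "2 * u \<le> exp u - exp (- u)"
    using real_le_x_sinh[of u] by (simp add: u_def exp_minus)
  then have "(2 * u)\<^sup>2 \<le> (exp u - exp (- u))\<^sup>2"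
    by (intro power_mono) (auto simp: u_def)
  also have "\<dots> = exp (2 * u) + exp (- (2 * u)) - 2"
    by (simp add: power2_eq_square algebra_simps flip: exp_add)
  finally have bound: "s\<^sup>2 \<le> exp \<bar>s\<bar> + exp (- \<bar>s\<bar>) - 2" by (simp add: u_def)
  have "x / y = exp s" "y / x = exp (- s)"
    using assms by (simp_all add: s_def exp_diff exp_minus)
  then show ?thesis
    using bound by (simp add: s_def[symmetric] abs_if split: if_splits)
qed

text \<open>The right-hand side is \<open>\<parallel>X\<^bsup>-1/2\<^esup> (X - Y) Y\<^bsup>-1/2\<^esup>\<parallel>\<^sup>2\<close>. It dominates pair by pair of
eigenvalues, and it exceeds \<open>riem_dist X Y\<close> squared only by terms of higher order when \<open>X\<close> and
\<open>Y\<close> are close, which is what makes it usable on short pieces of a geodesic.\<close>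

lemma norm_hlog_diff_sq_le_trace:
  fixes X X' Y Y' :: "complex^'n^'n"
  assumes X: "pos_def X" "X ** X' = mat 1" and Y: "pos_def Y" "Y ** Y' = mat 1"
  shows "(norm (hlog X - hlog Y))\<^sup>2
    \<le> Re (trace (X' ** Y)) + Re (trace (Y' ** X)) - 2 * Re (trace (mat 1 :: complex^'n^'n))"
    (is "_ \<le> ?rhs")
proof -
  obtain U x where U: "unitary U" and Xd: "X = udiag U x" and x: "\<And>i. 0 < x i"
    using pos_def_diagonalizable[OF X(1)] by blast
  obtain V y where V: "unitary V" and Yd: "Y = udiag V y" and y: "\<And>i. 0 < y i"
    using pos_def_diagonalizable[OF Y(1)] by blast
  have inv: "Z' = udiag W (\<lambda>i. inverse (z i))"
    if W: "unitary W" and z: "\<And>i. 0 < z i" and Z: "udiag W z ** Z' = mat 1" for W z and Z' :: "complex^'n^'n"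
  proof -
    have "udiag W (\<lambda>i. inverse (z i)) ** udiag W z = mat 1"
      using z by (simp add: udiag_mult[OF W] udiag_const[OF W] less_imp_neq[OF z, symmetric])
    then show ?thesis by (metis Z matrix_mul_assoc matrix_mul_lid matrix_mul_rid)
  qed
  have X': "X' = udiag U (\<lambda>i. inverse (x i))" and Y': "Y' = udiag V (\<lambda>i. inverse (y i))"
    using inv[OF U x] inv[OF V y] X(2) Y(2) Xd Yd by auto
  define w where "w i j = (norm ((U\<^sup>\<dagger> ** V) $ i $ j))\<^sup>2" for i j
  have n: "Re (trace (mat 1 :: complex^'n^'n)) = (\<Sum>i\<in>UNIV. \<Sum>j\<in>UNIV. w i j)"
    using Re_trace_udiag_mult[of U "\<lambda>_. 1" V "\<lambda>_. 1"] by (simp add: udiag_const U V w_def)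
  have "(norm (hlog X - hlog Y))\<^sup>2 = (\<Sum>i\<in>UNIV. \<Sum>j\<in>UNIV. (ln (x i) - ln (y j))\<^sup>2 * w i j)"
    by (simp add: Xd Yd herm_fun_udiag U V norm_udiag_diff_sq w_def)
  also have "\<dots> \<le> (\<Sum>i\<in>UNIV. \<Sum>j\<in>UNIV. (x i / y j + y j / x i - 2) * w i j)"
    by (intro sum_mono mult_right_mono ln_diff_sq_le x y) (simp add: w_def)
  also have "\<dots> = (\<Sum>i\<in>UNIV. \<Sum>j\<in>UNIV. inverse (x i) * y j * w i j)
      + (\<Sum>i\<in>UNIV. \<Sum>j\<in>UNIV. x i * inverse (y j) * w i j) - 2 * (\<Sum>i\<in>UNIV. \<Sum>j\<in>UNIV. w i j)"
    by (simp add: sum_distrib_left algebra_simps sum.distrib sum_subtractf divide_inverse)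
  also have "\<dots> = ?rhs"
    unfolding n X' Y' trace_mul_sym[of "udiag V _"] Xd Yd Re_trace_udiag_mult w_def ..
  finally show ?thesis .
qed

text \<open>The logarithm does not increase distances (exponential metric increasing property). The curve
\<open>P t = C E(t) C\<close> is the geodesic from \<open>X\<close> to \<open>Y\<close>. By cyclicity of the trace the chord estimate
for the step from \<open>P s\<close> to \<open>P (s + \<epsilon>)\<close> depends on \<open>\<epsilon>\<close> only; \<open>N\<close> steps of length \<open>1/N\<close> add up to
\<open>N sqrt (\<Sum> 4 sinh\<^sup>2 (h\<^sub>i / 2N))\<close>, which tends to the length \<open>sqrt (\<Sum> h\<^sub>i\<^sup>2)\<close> of the geodesic.\<close>

theorem norm_hlog_diff_le_riem_dist:
  fixes X Y :: "complex^'n^'n"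
  assumes X: "pos_def X" and Y: "pos_def Y"
  shows "norm (hlog X - hlog Y) \<le> riem_dist X Y"
proof -
  define R where "R = inv_sqrt X"
  obtain C where C: "C\<^sup>\<dagger> = C" "R\<^sup>\<dagger> = R" "C ** C = X" "C ** R = mat 1" "R ** C = mat 1"
    using pos_def_sqrt[OF X] unfolding R_def by metis
  have cancel: "C ** (R ** A) = A" "R ** (C ** A) = A" for A
    using C by (simp_all add: matrix_mul_assoc)
  have "pos_def (R ** Y ** R)"
    using pos_def_sandwich[OF Y C(5)] C(2) by simp
  then obtain V z where V: "unitary V" and Z: "R ** Y ** R = udiag V z" and z: "\<And>i. 0 < z i"
    using pos_def_diagonalizable by blast
  define h where "h i = ln (z i)" for i
  define E where "E t = udiag V (\<lambda>i. exp (t * h i))" for t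
  have EE: "E s ** E t = E (s + t)" for s t
    by (simp add: E_def udiag_mult[OF V] algebra_simps flip: exp_add)
  have E0: "E 0 = mat 1" by (simp add: E_def udiag_const[OF V])
  have E1: "E 1 = R ** Y ** R" using z by (simp add: E_def h_def Z)
  define P where "P t = C ** E t ** C" for t
  define Q where "Q t = R ** E (- t) ** R" for t
  have P0: "P 0 = X" by (simp add: P_def E0 C)
  have P1: "P 1 = Y"
    unfolding P_def E1 by (simp add: cancel C(5) flip: matrix_mul_assoc)
  have pos: "pos_def (P t)" for t
    using pos_def_sandwich[OF _ C(4), of "E t"] C(1) by (simp add: P_def E_def pos_def_udiag V)
  have PQ: "P t ** Q t = mat 1" for t
  proof -
    have "P t ** Q t = C ** (E t ** E (- t)) ** R"
      by (simp add: P_def Q_def cancel flip: matrix_mul_assoc)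
    then show ?thesis by (simp add: EE E0 C)
  qed
  have trQP: "Re (trace (Q s ** P t)) = (\<Sum>i\<in>UNIV. exp ((t - s) * h i))" for s t
  proof -
    have "Q s ** P t = R ** (E (t - s) ** C)"
      using EE[of "- s" t] by (simp add: P_def Q_def cancel flip: matrix_mul_assoc)
        (simp add: matrix_mul_assoc)
    then have "trace (Q s ** P t) = trace (E (t - s) ** C ** R)"
      by (simp add: trace_mul_sym[of R])
    also have "\<dots> = trace (E (t - s) ** E 0)"
      by (simp add: C E0 flip: matrix_mul_assoc)
    finally show ?thesis
      by (simp add: E_def Re_trace_udiag_mult unitaryD[OF V] mat_def if_distrib[of norm]
          if_distrib[of "\<lambda>x. x\<^sup>2"] if_distrib[of "\<lambda>x. _ * x"] cong: if_cong)
  qed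
  define g where "g \<epsilon> = (\<Sum>i\<in>UNIV. exp (\<epsilon> * h i) + exp (- \<epsilon> * h i) - 2)" for \<epsilon>
  have step: "norm (hlog (P s) - hlog (P (s + \<epsilon>))) \<le> sqrt (g \<epsilon>)" for s \<epsilon>
  proof (rule real_le_rsqrt)
    have "Re (trace (mat 1 :: complex^'n^'n)) = (\<Sum>i\<in>(UNIV :: 'n set). 1)"
      using trQP[of 0 0] PQ[of 0] by (simp add: trace_def mat_def)
    then show "(norm (hlog (P s) - hlog (P (s + \<epsilon>))))\<^sup>2 \<le> g \<epsilon>"
      using norm_hlog_diff_sq_le_trace[OF pos PQ pos PQ, of s "s + \<epsilon>"]
      by (simp add: trQP g_def sum.distrib sum_subtractf)
  qed
  have bound: "norm (hlog X - hlog Y) \<le> sqrt (\<Sum>i\<in>UNIV. (real N)\<^sup>2 * (exp (1 / real N * h i) + exp (- (1 / real N) * h i) - 2))"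
    if "N > 0" for N
  proof -
    have "norm (hlog (P 0) - hlog (P (real k * (1 / real N)))) \<le> real k * sqrt (g (1 / real N))" for k
    proof (induction k)
      case (Suc k)
      have "real (Suc k) * (1 / real N) = real k * (1 / real N) + 1 / real N"
        by (simp add: add_divide_distrib)
      then show ?case
        using Suc step[of "real k * (1 / real N)" "1 / real N"]
          norm_triangle_ineq[of "hlog (P 0) - hlog (P (real k * (1 / real N)))"
            "hlog (P (real k * (1 / real N))) - hlog (P (real k * (1 / real N) + 1 / real N))"]
        by (simp add: algebra_simps)
    qed simp
    from this[of N] have "norm (hlog X - hlog Y) \<le> real N * sqrt (g (1 / real N))"
      using that by (simp add: P0 P1)
    also have "\<dots> = sqrt ((real N)\<^sup>2 * g (1 / real N))"
      by (simp add: real_sqrt_mult)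
    finally show ?thesis by (simp add: g_def sum_distrib_left)
  qed
  have lim: "(\<lambda>N. (real N)\<^sup>2 * (exp (1 / real N * c) + exp (- (1 / real N) * c) - 2)) \<longlonglongrightarrow> c\<^sup>2" for c :: real
    unfolding power2_eq_square by real_asymp
  have "(\<lambda>N. sqrt (\<Sum>i\<in>UNIV. (real N)\<^sup>2 * (exp (1 / real N * h i) + exp (- (1 / real N) * h i) - 2)))
      \<longlonglongrightarrow> sqrt (\<Sum>i\<in>UNIV. (h i)\<^sup>2)"
    by (intro tendsto_real_sqrt tendsto_sum lim)
  then have "norm (hlog X - hlog Y) \<le> sqrt (\<Sum>i\<in>UNIV. (h i)\<^sup>2)"
    by (rule tendsto_lowerbound) (use bound in \<open>auto intro: eventually_sequentiallyI[of 1]\<close>)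
  also have "\<dots> = sqrt ((norm (udiag V h))\<^sup>2)"
    by (simp only: norm_udiag_sq[OF V])
  also have "\<dots> = riem_dist X Y"
    by (simp add: riem_dist_eq flip: R_def) (simp add: Z herm_fun_udiag[OF V] flip: h_def)
  finally show ?thesis .
qed

lemma riem_dist_one: "riem_dist (mat 1) A = norm (hlog A)"
proof -
  note U = unitary_one[where 'n = 'a]
  have "inv_sqrt (mat 1 :: complex^'a^'a) = mat 1"
    using herm_fun_udiag[OF U, of "\<lambda>t. t powr (- 1 / 2)" "\<lambda>_. 1"] by (simp add: udiag_const[OF U] inv_sqrt_def)
  then show ?thesis by (simp add: riem_dist_eq)
qed

text \<open>The matrices whose logarithms are compared on the two sides differ by conjugation with
\<open>W = (S X S\<^sup>\<dagger>)\<^bsup>-1/2\<^esup> S X\<^bsup>1/2\<^esup>\<close>, which is unitary.\<close>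

lemma riem_dist_congruence:
  assumes X: "pos_def X" and Y: "pos_def Y" and S: "S ** T = mat 1"
  shows "riem_dist (S ** X ** S\<^sup>\<dagger>) (S ** Y ** S\<^sup>\<dagger>) = riem_dist X Y"
proof -
  define X2 where "X2 = S ** X ** S\<^sup>\<dagger>"
  have X2: "pos_def X2" unfolding X2_def by (rule pos_def_sandwich[OF X S])
  define R where "R = inv_sqrt X"
  define R2 where "R2 = inv_sqrt X2"
  obtain C where C: "C\<^sup>\<dagger> = C" "R\<^sup>\<dagger> = R" "C ** C = X" "C ** R = mat 1" "R ** C = mat 1"
    using pos_def_sqrt[OF X] unfolding R_def by metis
  have R2: "R2\<^sup>\<dagger> = R2" "R2 ** X2 ** R2 = mat 1"
    using pos_def_sqrt[OF X2] unfolding R2_def by metis+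
  define W where "W = R2 ** S ** C"
  have Wt: "W\<^sup>\<dagger> = C ** S\<^sup>\<dagger> ** R2" by (simp add: W_def conj_transpose_mult C R2 matrix_mul_assoc)
  have "W ** W\<^sup>\<dagger> = R2 ** S ** (C ** C) ** S\<^sup>\<dagger> ** R2"
    unfolding Wt unfolding W_def by (simp only: matrix_mul_assoc)
  also have "\<dots> = mat 1"
    using R2 by (simp add: C X2_def matrix_mul_assoc)
  finally have "unitary (W\<^sup>\<dagger>)" by (intro unitaryI) simp
  then have W: "unitary W" using unitary_conj_transpose by fastforce
  have "W ** (R ** Y ** R) ** W\<^sup>\<dagger> = R2 ** S ** (C ** R) ** Y ** (R ** C) ** S\<^sup>\<dagger> ** R2"
    unfolding Wt unfolding W_def by (simp only: matrix_mul_assoc)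
  also have "\<dots> = R2 ** (S ** Y ** S\<^sup>\<dagger>) ** R2"
    by (simp add: C matrix_mul_assoc)
  finally have eq: "R2 ** (S ** Y ** S\<^sup>\<dagger>) ** R2 = W ** (R ** Y ** R) ** W\<^sup>\<dagger>" ..
  have "hermitian (R ** Y ** R)"
    using Y hermitian_sandwich[of Y R] C by (simp add: pos_def_def)
  then show ?thesis
    unfolding riem_dist_eq X2_def[symmetric] R2_def[symmetric] R_def[symmetric] eq
    by (simp add: herm_fun_unitary_sandwich W norm_unitary_sandwich)
qed

lemma pos_def_inv_sqrt_sandwich:
  assumes "pos_def X" "pos_def Y"
  shows "pos_def (inv_sqrt X ** Y ** inv_sqrt X)"
  by (metis assms pos_def_sandwich pos_def_sqrt)

lemma riem_dist_inv_sqrt_sandwich: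
  assumes "pos_def X" "pos_def Y" "pos_def Z"
  shows "riem_dist (inv_sqrt X ** Y ** inv_sqrt X) (inv_sqrt X ** Z ** inv_sqrt X) = riem_dist Y Z"
  by (metis assms riem_dist_congruence pos_def_sqrt)

lemma riem_dist_nonneg: "0 \<le> riem_dist X Y"
  by (simp add: riem_dist_eq)

lemma hlog_one [simp]: "hlog (mat 1 :: complex^'n^'n) = 0"
proof -
  note U = unitary_one[where 'n = 'n]
  show ?thesis
    using herm_fun_udiag[OF U, of ln "\<lambda>_. 1"] by (simp add: udiag_const[OF U])
qed

lemma riem_dist_self:
  assumes "pos_def X"
  shows "riem_dist X X = 0"
proof -
  have "inv_sqrt X ** X ** inv_sqrt X = mat 1" by (metis assms pos_def_sqrt)
  then show ?thesis by (simp add: riem_dist_eq)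
qed

text \<open>After \<open>X\<close> has been moved to the identity, the distances from \<open>X\<close> are norms of logarithms, and
the logarithm does not increase the distance of \<open>Y\<close> and \<open>Z\<close>.\<close>

lemma riem_dist_reverse_triangle:
  assumes "pos_def X" "pos_def Y" "pos_def Z"
  shows "\<bar>riem_dist X Y - riem_dist X Z\<bar> \<le> riem_dist Y Z"
proof -
  have "\<bar>riem_dist X Y - riem_dist X Z\<bar>
      \<le> norm (hlog (inv_sqrt X ** Y ** inv_sqrt X) - hlog (inv_sqrt X ** Z ** inv_sqrt X))"
    unfolding riem_dist_eq by (rule norm_triangle_ineq3)
  also have "\<dots> \<le> riem_dist (inv_sqrt X ** Y ** inv_sqrt X) (inv_sqrt X ** Z ** inv_sqrt X)"
    using assms by (intro norm_hlog_diff_le_riem_dist pos_def_inv_sqrt_sandwich)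
  finally show ?thesis by (simp add: riem_dist_inv_sqrt_sandwich assms)
qed

text \<open>Symmetry is not visible in the definition, but it is the case \<open>Z = X\<close> of the reverse triangle
inequality, used in both directions.\<close>

lemma riem_dist_commute:
  assumes "pos_def X" "pos_def Y"
  shows "riem_dist X Y = riem_dist Y X"
  using riem_dist_reverse_triangle[of X Y X] riem_dist_reverse_triangle[of Y X Y]
    riem_dist_self[OF assms(1)] riem_dist_self[OF assms(2)] assms by (simp add: riem_dist_nonneg)

section \<open>The distance and the matrix topology\<close>

text \<open>Near the identity \<open>hlog Z\<close> and \<open>Z - mat 1\<close> have comparable norms. This estimate and the next one
show that the Riemannian distance induces the usual topology on the cone.\<close>

lemma norm_hlog_le:
  assumes "pos_def Z" "norm (Z - mat 1) \<le> 1 / 2"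
  shows "norm (hlog Z) \<le> 2 * norm (Z - mat 1)"
proof -
  obtain U z where U: "unitary U" and Z: "Z = udiag U z" and z: "\<And>i. 0 < z i"
    using pos_def_diagonalizable[OF assms(1)] by blast
  have "Z - mat 1 = udiag U (\<lambda>i. z i - 1)"
    using udiag_diff[of U z "\<lambda>_. 1"] by (simp add: Z udiag_const[OF U])
  then have nrm: "(norm (Z - mat 1))\<^sup>2 = (\<Sum>i\<in>UNIV. (z i - 1)\<^sup>2)"
    by (simp add: norm_udiag_sq[OF U])
  have ln: "(ln (z i))\<^sup>2 \<le> (2 * (z i - 1))\<^sup>2" for i
  proof -
    have "(z i - 1)\<^sup>2 \<le> (norm (Z - mat 1))\<^sup>2"
      unfolding nrm by (rule member_le_sum) auto
    also have "\<dots> \<le> (1 / 2)\<^sup>2" using assms(2) by (intro power_mono) auto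
    finally have small: "\<bar>z i - 1\<bar> \<le> 1 / 2" by (simp add: abs_le_square_iff[symmetric])
    have "\<bar>ln (1 + (z i - 1)) - (z i - 1)\<bar> \<le> 2 * (z i - 1)\<^sup>2"
      by (rule abs_ln_one_plus_x_minus_x_bound[OF small])
    also have "\<dots> \<le> \<bar>z i - 1\<bar>"
      using mult_right_mono[OF small, of "\<bar>z i - 1\<bar>"] by (simp add: power2_eq_square)
    finally show ?thesis by (simp only: abs_le_square_iff[symmetric]) auto
  qed
  have "(norm (hlog Z))\<^sup>2 = (\<Sum>i\<in>UNIV. (ln (z i))\<^sup>2)"
    by (simp add: Z herm_fun_udiag[OF U] norm_udiag_sq[OF U])
  also have "\<dots> \<le> (\<Sum>i\<in>UNIV. (2 * (z i - 1))\<^sup>2)" by (intro sum_mono ln)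
  also have "\<dots> = (2 * norm (Z - mat 1))\<^sup>2"
    by (simp only: power_mult_distrib nrm sum_distrib_left)
  finally show ?thesis by (rule power2_le_imp_le) simp
qed

lemma norm_diff_one_le:
  assumes "pos_def Z" "norm (hlog Z) \<le> 1"
  shows "norm (Z - mat 1) \<le> 2 * norm (hlog Z)"
proof -
  obtain U z where U: "unitary U" and Z: "Z = udiag U z" and z: "\<And>i. 0 < z i"
    using pos_def_diagonalizable[OF assms(1)] by blast
  have nrm: "(norm (hlog Z))\<^sup>2 = (\<Sum>i\<in>UNIV. (ln (z i))\<^sup>2)"
    by (simp add: Z herm_fun_udiag[OF U] norm_udiag_sq[OF U])
  have ln: "(z i - 1)\<^sup>2 \<le> (2 * ln (z i))\<^sup>2" for i
  proof -
    define h where "h = ln (z i)"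
    have zi: "z i = exp h" using z by (simp add: h_def)
    have "h\<^sup>2 \<le> (norm (hlog Z))\<^sup>2"
      unfolding nrm h_def by (rule member_le_sum) auto
    also have "\<dots> \<le> 1\<^sup>2" using assms(2) by (intro power_mono) auto
    finally have small: "\<bar>h\<bar> \<le> 1" by (simp add: abs_square_le_1)
    have "\<bar>exp h - 1\<bar> \<le> 2 * \<bar>h\<bar>"
    proof (cases "h \<ge> 0")
      case True
      have "h\<^sup>2 \<le> h" using True small mult_right_mono[of h 1 h] by (simp add: power2_eq_square)
      then show ?thesis using exp_bound[of h] True small by simp
    next
      case False
      then have "exp h \<le> 1" by simp
      then show ?thesis using False exp_ge_add_one_self[of h] by linarith
    qed
    then show ?thesis unfolding zi by (simp only: abs_le_square_iff[symmetric]) (simp add: abs_mult)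
  qed
  have "Z - mat 1 = udiag U (\<lambda>i. z i - 1)"
    using udiag_diff[of U z "\<lambda>_. 1"] by (simp add: Z udiag_const[OF U])
  then have "(norm (Z - mat 1))\<^sup>2 = (\<Sum>i\<in>UNIV. (z i - 1)\<^sup>2)"
    by (simp add: norm_udiag_sq[OF U])
  also have "\<dots> \<le> (\<Sum>i\<in>UNIV. (2 * ln (z i))\<^sup>2)" by (intro sum_mono ln)
  also have "\<dots> = (2 * norm (hlog Z))\<^sup>2"
    by (simp only: power_mult_distrib nrm sum_distrib_left)
  finally show ?thesis by (rule power2_le_imp_le) simp
qed

lemma tendsto_riem_dist_0:
  assumes X: "pos_def X" and Y: "\<forall>\<^sub>F k in F. pos_def (Y k)" and lim: "(Y \<longlongrightarrow> X) F"
  shows "((\<lambda>k. riem_dist X (Y k)) \<longlongrightarrow> 0) F"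
proof -
  define Z where "Z k = inv_sqrt X ** Y k ** inv_sqrt X" for k
  have "((\<lambda>k. Z k) \<longlongrightarrow> inv_sqrt X ** X ** inv_sqrt X) F"
    unfolding Z_def by (rule bounded_linear.tendsto[OF bounded_linear_sandwich lim])
  moreover have "inv_sqrt X ** X ** inv_sqrt X = mat 1" by (metis X pos_def_sqrt)
  ultimately have Z: "((\<lambda>k. norm (Z k - mat 1)) \<longlongrightarrow> 0) F"
    by (simp add: tendsto_norm_zero_iff LIM_zero_iff)
  have "\<forall>\<^sub>F k in F. norm (Z k - mat 1) \<le> 1 / 2"
    using order_tendstoD(2)[OF Z, of "1 / 2"] by (auto elim: eventually_mono)
  with Y have "\<forall>\<^sub>F k in F. norm (riem_dist X (Y k)) \<le> 2 * norm (Z k - mat 1)"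
    by eventually_elim (use norm_hlog_le pos_def_inv_sqrt_sandwich[OF X] in \<open>auto simp: riem_dist_eq Z_def\<close>)
  moreover have "((\<lambda>k. 2 * norm (Z k - mat 1)) \<longlongrightarrow> 0) F"
    using tendsto_mult_right_zero[OF Z] .
  ultimately show ?thesis by (rule Lim_null_comparison)
qed

lemma riem_dist_tendsto_0D:
  assumes X: "pos_def X" and Y: "\<forall>\<^sub>F k in F. pos_def (Y k)"
    and lim: "((\<lambda>k. riem_dist X (Y k)) \<longlongrightarrow> 0) F"
  shows "(Y \<longlongrightarrow> X) F"
proof -
  define R where "R = inv_sqrt X"
  obtain C where C: "C\<^sup>\<dagger> = C" "R\<^sup>\<dagger> = R" "C ** C = X" "C ** R = mat 1" "R ** C = mat 1"
    using pos_def_sqrt[OF X] unfolding R_def by metis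
  define Z where "Z k = R ** Y k ** R" for k
  have "\<forall>\<^sub>F k in F. riem_dist X (Y k) \<le> 1"
    using order_tendstoD(2)[OF lim, of 1] by (auto elim: eventually_mono)
  with Y have "\<forall>\<^sub>F k in F. norm (norm (Z k - mat 1)) \<le> 2 * riem_dist X (Y k)"
    by eventually_elim
       (use norm_diff_one_le pos_def_inv_sqrt_sandwich[OF X] in \<open>auto simp: riem_dist_eq Z_def R_def\<close>)
  moreover have "((\<lambda>k. 2 * riem_dist X (Y k)) \<longlongrightarrow> 0) F"
    using tendsto_mult_right_zero[OF lim] .
  ultimately have "((\<lambda>k. norm (Z k - mat 1)) \<longlongrightarrow> 0) F"
    by (rule Lim_null_comparison)
  then have "(Z \<longlongrightarrow> mat 1) F"
    by (simp add: tendsto_norm_zero_iff LIM_zero_iff)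
  then have "((\<lambda>k. C ** Z k ** C) \<longlongrightarrow> C ** mat 1 ** C) F"
    by (rule bounded_linear.tendsto[OF bounded_linear_sandwich])
  moreover have "C ** Z k ** C = Y k" for k
  proof -
    have "C ** Z k ** C = (C ** R) ** Y k ** (R ** C)"
      unfolding Z_def by (simp only: matrix_mul_assoc)
    then show ?thesis by (simp add: C)
  qed
  ultimately show ?thesis by (simp add: C)
qed

lemma riem_dist_eq_0D:
  assumes "pos_def X" "pos_def Y" "riem_dist X Y = 0"
  shows "X = Y"
  using riem_dist_tendsto_0D[of X "\<lambda>_. Y" sequentially] assms by (simp add: LIMSEQ_const_iff)

lemma continuous_on_riem_dist:
  assumes A: "pos_def A"
  shows "continuous_on {X. pos_def X} (\<lambda>X. riem_dist X A)"
  unfolding continuous_on_def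
proof
  fix X :: "complex^'a^'a" assume "X \<in> {X. pos_def X}"
  then have X: "pos_def X" by simp
  have ev: "\<forall>\<^sub>F Y in at X within {X. pos_def X}. pos_def Y"
    by (simp add: eventually_at_filter)
  have "((\<lambda>Y. riem_dist X Y) \<longlongrightarrow> 0) (at X within {X. pos_def X})"
    by (rule tendsto_riem_dist_0[OF X ev]) (rule tendsto_ident_at)
  moreover have "\<forall>\<^sub>F Y in at X within {X. pos_def X}. norm (riem_dist Y A - riem_dist X A) \<le> riem_dist X Y"
    using ev by eventually_elim
      (use riem_dist_reverse_triangle[OF A X] X in \<open>auto simp: riem_dist_commute[OF _ A] abs_minus_commute\<close>)
  ultimately have "((\<lambda>Y. riem_dist Y A - riem_dist X A) \<longlongrightarrow> 0) (at X within {X. pos_def X})"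
    by (rule Lim_null_comparison[rotated])
  then show "((\<lambda>Y. riem_dist Y A) \<longlongrightarrow> riem_dist X A) (at X within {X. pos_def X})"
    by (simp add: LIM_zero_iff)
qed

lemma tendsto_hlog:
  assumes X: "pos_def X" and Y: "\<forall>\<^sub>F k in F. pos_def (Y k)" and lim: "(Y \<longlongrightarrow> X) F"
  shows "((\<lambda>k. hlog (Y k)) \<longlongrightarrow> hlog X) F"
proof -
  have "\<forall>\<^sub>F k in F. norm (hlog (Y k) - hlog X) \<le> riem_dist X (Y k)"
    using Y by eventually_elim
      (simp add: norm_hlog_diff_le_riem_dist[OF X] norm_minus_commute[of _ "hlog X"])
  then have "((\<lambda>k. hlog (Y k) - hlog X) \<longlongrightarrow> 0) F"
    by (rule Lim_null_comparison) (rule tendsto_riem_dist_0[OF assms])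
  then show ?thesis by (simp add: LIM_zero_iff)
qed

section \<open>The Loewner order\<close>

lemma pos_semidef_add: "pos_semidef A \<Longrightarrow> pos_semidef B \<Longrightarrow> pos_semidef (A + B)"
  by (simp add: pos_semidef_def hermitian_def conj_transpose_add quad_form_hinner
      matrix_vector_mult_add_rdistrib hinner_add_right)

lemma scaleR_mult_vector: "(c *\<^sub>R A) *v x = c *\<^sub>R (A *v (x :: complex^'n))"
  by (simp add: vec_eq_iff matrix_vector_mult_def scaleR_sum_right)

lemma pos_semidef_scaleR: "pos_semidef A \<Longrightarrow> 0 \<le> c \<Longrightarrow> pos_semidef (c *\<^sub>R A)"
  by (simp add: pos_semidef_def hermitian_def conj_transpose_scaleR quad_form_hinner
      hinner_scaleR_right scaleR_mult_vector)

lemma pos_semidef_sum: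
  "(\<And>i. i \<in> I \<Longrightarrow> pos_semidef (f i)) \<Longrightarrow> pos_semidef (\<Sum>i\<in>I. f i)"
proof (induction I rule: infinite_finite_induct)
  case (insert i I)
  then show ?case by (simp add: pos_semidef_add)
qed (simp_all add: pos_semidef_def hermitian_def quad_form_def vec_eq_iff)

lemma bounded_linear_Re_quad_form: "bounded_linear (\<lambda>A :: complex^'n^'n. Re (quad_form A x))"
  by (rule linear_conv_bounded_linear[THEN iffD1], rule linearI)
     (simp_all add: quad_form_hinner matrix_vector_mult_add_rdistrib hinner_add_right
       hinner_scaleR_right scaleR_mult_vector)

lemma closed_pos_semidef: "closed {A :: complex^'n^'n. pos_semidef A}"
  unfolding pos_semidef_def hermitian_def
  by (intro closed_Collect_conj closed_Collect_all closed_Collect_eq closed_Collect_le continuous_intros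
      linear_continuous_on bounded_linear_conj_transpose bounded_linear_Re_quad_form)

lemma pos_semidef_udiag_bounds:
  assumes U: "unitary U"
  shows "pos_semidef (udiag U x - c *\<^sub>R mat 1) \<longleftrightarrow> (\<forall>i. c \<le> x i)"
    and "pos_semidef (c *\<^sub>R mat 1 - udiag U x) \<longleftrightarrow> (\<forall>i. x i \<le> c)"
  by (simp_all add: udiag_diff pos_semidef_udiag[OF U] flip: udiag_const[OF U])

lemma hermitian_of_pos_semidef_diff:
  assumes "pos_semidef (X - c *\<^sub>R mat 1)"
  shows "hermitian X"
  using assms by (simp add: pos_semidef_def hermitian_def conj_transpose_diff conj_transpose_scaleR)

text \<open>Compact sets of positive definite matrices that exhaust the cone and contain the Riemannian
balls around the identity.\<close>

definition loewner_box :: "real \<Rightarrow> (complex^'n^'n) set" where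
  "loewner_box r = {X. pos_semidef (X - exp (- r) *\<^sub>R mat 1) \<and> pos_semidef (exp r *\<^sub>R mat 1 - X)}"

lemma loewner_box_diagonalizable:
  assumes "X \<in> loewner_box r"
  obtains U x where "unitary U" "X = udiag U x" "\<And>i. exp (- r) \<le> x i" "\<And>i. x i \<le> exp r"
proof -
  have "hermitian X"
    using assms by (auto simp: loewner_box_def intro: hermitian_of_pos_semidef_diff)
  then obtain U x where U: "unitary U" and X: "X = udiag U x"
    by (rule hermitian_diagonalizable)
  with assms that show ?thesis by (auto simp: loewner_box_def pos_semidef_udiag_bounds)
qed

lemma loewner_box_pos_def:
  assumes "X \<in> loewner_box r"
  shows "pos_def X"
proof -
  obtain U x where U: "unitary U" and X: "X = udiag U x" and x: "\<And>i. exp (- r) \<le> x i"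
    using loewner_box_diagonalizable[OF assms] by blast
  show ?thesis using less_le_trans[OF exp_gt_zero x] by (simp add: X pos_def_udiag[OF U])
qed

lemma norm_loewner_box_le:
  assumes "(X :: complex^'n^'n) \<in> loewner_box r"
  shows "norm X \<le> sqrt (real CARD('n)) * exp r"
proof -
  obtain U x where U: "unitary U" and X: "X = udiag U x"
    and x: "\<And>i. exp (- r) \<le> x i" "\<And>i. x i \<le> exp r"
    using loewner_box_diagonalizable[OF assms] by blast
  have "(norm X)\<^sup>2 = (\<Sum>i\<in>UNIV. (x i)\<^sup>2)" by (simp add: X norm_udiag_sq[OF U])
  also have "\<dots> \<le> (\<Sum>i\<in>(UNIV :: 'n set). (exp r)\<^sup>2)"
    using x(2) order.trans[OF exp_ge_zero x(1)] by (intro sum_mono power_mono) auto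
  also have "\<dots> = (sqrt (real CARD('n)) * exp r)\<^sup>2" by (simp add: power_mult_distrib)
  finally show ?thesis by (rule power2_le_imp_le) simp
qed

lemma compact_loewner_box: "compact (loewner_box r :: (complex^'n^'n) set)"
proof -
  have "closed (loewner_box r :: (complex^'n^'n) set)"
  proof -
    have "(loewner_box r :: (complex^'n^'n) set) = (\<lambda>X. X - exp (- r) *\<^sub>R mat 1) -` {A. pos_semidef A}
        \<inter> (\<lambda>X. exp r *\<^sub>R mat 1 - X) -` {A. pos_semidef A}"
      by (auto simp: loewner_box_def)
    moreover have "closed ((\<lambda>X. X - exp (- r) *\<^sub>R mat 1) -` {A :: complex^'n^'n. pos_semidef A})"
      by (intro continuous_closed_vimage closed_pos_semidef continuous_intros)
    moreover have "closed ((\<lambda>X. exp r *\<^sub>R mat 1 - X) -` {A :: complex^'n^'n. pos_semidef A})"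
      by (intro continuous_closed_vimage closed_pos_semidef continuous_intros)
    ultimately show ?thesis by (simp add: closed_Int)
  qed
  moreover have "bounded (loewner_box r :: (complex^'n^'n) set)"
    using norm_loewner_box_le by (auto simp: bounded_iff)
  ultimately show ?thesis by (simp add: compact_eq_bounded_closed)
qed

lemma mem_loewner_box_of_riem_dist:
  assumes "pos_def X" "riem_dist (mat 1) X \<le> r"
  shows "X \<in> loewner_box r"
proof -
  obtain U x where U: "unitary U" and X: "X = udiag U x" and x: "\<And>i. 0 < x i"
    using pos_def_diagonalizable[OF assms(1)] by blast
  have "exp (- r) \<le> x i \<and> x i \<le> exp r" for i
  proof -
    have "(ln (x i))\<^sup>2 \<le> (\<Sum>i\<in>UNIV. (ln (x i))\<^sup>2)" by (rule member_le_sum) auto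
    also have "\<dots> = (riem_dist (mat 1) X)\<^sup>2"
      by (simp add: riem_dist_one X herm_fun_udiag[OF U] norm_udiag_sq[OF U])
    finally have "\<bar>ln (x i)\<bar> \<le> \<bar>riem_dist (mat 1) X\<bar>" by (simp add: abs_le_square_iff)
    then have "- r \<le> ln (x i)" "ln (x i) \<le> r" using assms(2) by (auto simp: riem_dist_nonneg)
    then show ?thesis using x[of i] by (metis exp_le_cancel_iff exp_ln)
  qed
  then show ?thesis by (simp add: loewner_box_def X pos_semidef_udiag_bounds[OF U])
qed

lemma pos_def_one [simp]: "pos_def (mat 1 :: complex^'n^'n)"
proof -
  note U = unitary_one[where 'n = 'n]
  show ?thesis using pos_def_udiag[OF U, of "\<lambda>_. 1"] by (simp add: udiag_const[OF U])
qed

lemma matrix_inv_eqI: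
  fixes A B :: "complex^'n^'n"
  assumes "A ** B = mat 1"
  shows "matrix_inv A = B"
proof -
  have BA: "B ** A = mat 1" using assms matrix_left_right_inverse by blast
  have "A ** matrix_inv A = mat 1"
    unfolding matrix_inv_def by (rule someI2[of _ B]) (use assms BA in auto)
  then show ?thesis by (metis BA matrix_mul_assoc matrix_mul_lid matrix_mul_rid)
qed

lemma matrix_inv_udiag:
  assumes U: "unitary U" and d: "\<And>i. 0 < d i"
  shows "matrix_inv (udiag U d) = udiag U (\<lambda>i. 1 / d i)"
  by (rule matrix_inv_eqI)
     (use d in \<open>simp add: udiag_mult[OF U] udiag_const[OF U] less_imp_neq[OF d, symmetric]\<close>)

lemma pos_def_matrix_inv:
  assumes "pos_def A"
  shows "pos_def (matrix_inv A)" "A ** matrix_inv A = mat 1" "matrix_inv A ** A = mat 1"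
proof -
  obtain U d where U: "unitary U" and A: "A = udiag U d" and d: "\<And>i. 0 < d i"
    using pos_def_diagonalizable[OF assms] by blast
  show "pos_def (matrix_inv A)" by (simp add: A matrix_inv_udiag[OF U d] pos_def_udiag[OF U] d)
  show "A ** matrix_inv A = mat 1" "matrix_inv A ** A = mat 1"
    by (simp_all add: A matrix_inv_udiag[OF U d] udiag_mult[OF U] udiag_const[OF U]
        less_imp_neq[OF d, symmetric])
qed

text \<open>The scalar inequalities \<open>ln t \<le> t - 1\<close> and \<open>- ln t \<le> 1/t - 1\<close> on the spectrum. They are the
source of the arithmetic and the harmonic mean.\<close>

lemma hlog_le_minus_one: "pos_def B \<Longrightarrow> pos_semidef (B - mat 1 - hlog B)"
  and minus_hlog_le_inv_minus_one: "pos_def B \<Longrightarrow> pos_semidef (matrix_inv B - mat 1 + hlog B)"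
proof -
  assume "pos_def B"
  then obtain U d where U: "unitary U" and B: "B = udiag U d" and d: "\<And>i. 0 < d i"
    using pos_def_diagonalizable by blast
  have one: "mat 1 = udiag U (\<lambda>_. 1)" by (simp add: udiag_const[OF U])
  have "B - mat 1 - hlog B = udiag U (\<lambda>i. d i - 1 - ln (d i))"
    unfolding B herm_fun_udiag[OF U] one udiag_diff ..
  moreover have "0 \<le> d i - 1 - ln (d i)" for i
    using ln_le_minus_one[OF d[of i]] by simp
  ultimately show "pos_semidef (B - mat 1 - hlog B)" by (simp add: pos_semidef_udiag[OF U])
  have "matrix_inv B - mat 1 + hlog B = udiag U (\<lambda>i. 1 / d i - 1 + ln (d i))"
    unfolding B herm_fun_udiag[OF U] matrix_inv_udiag[OF U d] one udiag_diff udiag_add ..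
  moreover have "0 \<le> 1 / d i - 1 + ln (d i)" for i
    using ln_le_minus_one[of "1 / d i"] d[of i] by (simp add: ln_div)
  ultimately show "pos_semidef (matrix_inv B - mat 1 + hlog B)" by (simp add: pos_semidef_udiag[OF U])
qed

lemma tendsto_matrix_mult:
  fixes f g :: "'a \<Rightarrow> complex^'n^'n"
  assumes "(f \<longlongrightarrow> A) F" "(g \<longlongrightarrow> B) F"
  shows "((\<lambda>k. f k ** g k) \<longlongrightarrow> A ** B) F"
  by (intro vec_tendstoI) (auto simp: matrix_matrix_mult_def intro!: tendsto_intros assms tendsto_vec_nth)

lemma tendsto_udiag:
  assumes "\<And>i. ((\<lambda>k. d k i) \<longlongrightarrow> e i) F"
  shows "((\<lambda>k. udiag U (d k)) \<longlongrightarrow> udiag U e) F"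
  by (intro vec_tendstoI) (auto simp: udiag_nth intro!: tendsto_intros assms)

lemma pos_def_imp_pos_semidef: "pos_def A \<Longrightarrow> pos_semidef A"
  unfolding pos_def_def pos_semidef_def
  by (metis Re_hinner inner_zero_left less_imp_le order_refl quad_form_hinner)

section \<open>The weighted geometric mean\<close>

locale weighted_points =
  fixes I :: "'i set" and w :: "'i \<Rightarrow> real" and A :: "'i \<Rightarrow> complex^'n^'n"
  assumes finite_I: "finite I" and w_nonneg: "\<And>i. i \<in> I \<Longrightarrow> 0 \<le> w i" and w_sum: "sum w I = 1"
    and A_pos: "\<And>i. i \<in> I \<Longrightarrow> pos_def (A i)"
begin

definition cost :: "complex^'n^'n \<Rightarrow> real" where
  "cost X = (\<Sum>i\<in>I. w i * (riem_dist X (A i))\<^sup>2)"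

text \<open>Up to the factor \<open>-2\<close> this is the gradient of the cost at \<open>X\<close>, transported to the identity.\<close>

definition log_sum :: "complex^'n^'n \<Rightarrow> complex^'n^'n" where
  "log_sum X = (\<Sum>i\<in>I. w i *\<^sub>R hlog (inv_sqrt X ** A i ** inv_sqrt X))"

text \<open>Strong convexity along geodesics, with its first order term. Seen from \<open>X\<close> at the identity,
\<open>riem_dist Y (A i)\<close> is at least the Euclidean distance of the logarithms, whose squares expand as
in a Hilbert space.\<close>

lemma cost_ge:
  assumes X: "pos_def X" and Y: "pos_def Y"
  shows "cost Y \<ge> cost X - 2 * (log_sum X \<bullet> hlog (inv_sqrt X ** Y ** inv_sqrt X)) + (riem_dist X Y)\<^sup>2"
proof -
  define K where "K = hlog (inv_sqrt X ** Y ** inv_sqrt X)"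
  define H where "H i = hlog (inv_sqrt X ** A i ** inv_sqrt X)" for i
  have K: "norm K = riem_dist X Y" and H: "norm (H i) = riem_dist X (A i)" for i
    by (simp_all add: K_def H_def riem_dist_eq)
  have "norm (K - H i) \<le> riem_dist Y (A i)" if "i \<in> I" for i
    unfolding K_def H_def riem_dist_inv_sqrt_sandwich[OF X Y A_pos[OF that], symmetric]
    by (intro norm_hlog_diff_le_riem_dist pos_def_inv_sqrt_sandwich X Y A_pos that)
  then have "cost Y \<ge> (\<Sum>i\<in>I. w i * (norm (K - H i))\<^sup>2)"
    unfolding cost_def by (intro sum_mono mult_left_mono power_mono) (auto simp: w_nonneg)
  also have "(\<Sum>i\<in>I. w i * (norm (K - H i))\<^sup>2)
      = (\<Sum>i\<in>I. w i * (norm (H i))\<^sup>2 - 2 * (w i * (H i \<bullet> K)) + w i * (norm K)\<^sup>2)"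
    by (intro sum.cong refl)
       (simp add: power2_norm_eq_inner inner_diff_left inner_diff_right inner_commute algebra_simps)
  also have "\<dots> = cost X - 2 * (log_sum X \<bullet> K) + (norm K)\<^sup>2"
    by (simp add: sum.distrib sum_subtractf cost_def log_sum_def H inner_sum_left sum_distrib_left
        flip: H_def) (simp add: w_sum flip: sum_distrib_right)
  finally show ?thesis by (simp add: K flip: K_def)
qed

text \<open>The first order condition, obtained from convexity instead of a derivative: the estimate
\<open>cost_ge\<close> is applied with the roles exchanged, that is, centred at \<open>Y t = exp (t H)\<close> and evaluated at
the identity. Minimality then forces \<open>log_sum (Y t) \<bullet> H \<le> 0\<close> for \<open>t > 0\<close>, and for \<open>t\<close> tending to
\<open>0\<close> the left-hand side tends to \<open>H \<bullet> H\<close>.\<close>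

lemma sum_hlog_eq_0_of_min_one:
  assumes min: "\<And>Y. pos_def Y \<Longrightarrow> cost (mat 1) \<le> cost Y"
  shows "(\<Sum>i\<in>I. w i *\<^sub>R hlog (A i)) = 0"
proof -
  define H where "H = (\<Sum>i\<in>I. w i *\<^sub>R hlog (A i))"
  have "hermitian (hlog (A i))" if "i \<in> I" for i
    using A_pos[OF that] by (elim pos_def_diagonalizable) (simp add: herm_fun_udiag hermitian_def)
  then have "hermitian H"
    unfolding H_def hermitian_def
    by (simp add: linear_sum[OF bounded_linear.linear[OF bounded_linear_conj_transpose]] conj_transpose_scaleR)
  then obtain V h where V: "unitary V" and H: "H = udiag V h" by (rule hermitian_diagonalizable)
  define Y where "Y t = udiag V (\<lambda>i. exp (t * h i))" for t
  define S where "S t = udiag V (\<lambda>i. exp (- (t / 2) * h i))" for t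
  have S: "inv_sqrt (Y t) = S t" for t
    by (simp add: S_def Y_def inv_sqrt_def herm_fun_udiag[OF V] powr_def)
  have Y: "pos_def (Y t)" for t by (simp add: Y_def pos_def_udiag[OF V])
  have SS: "hlog (S t ** mat 1 ** S t) = - t *\<^sub>R H" for t
    by (simp add: S_def udiag_mult[OF V] H herm_fun_udiag[OF V] udiag_scaleR flip: exp_add)
  have le: "log_sum (Y t) \<bullet> H \<le> 0" if "t > 0" for t
  proof -
    have "cost (mat 1) \<ge> cost (Y t) - 2 * (log_sum (Y t) \<bullet> (- t *\<^sub>R H))"
      using cost_ge[OF Y pos_def_one, of t] unfolding S SS by (smt (verit) zero_le_power2)
    with min[OF Y[of t]] have "t * (log_sum (Y t) \<bullet> H) \<le> 0" by simp
    then show ?thesis using that by (simp add: mult_le_0_iff)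
  qed
  have S1: "(S \<longlongrightarrow> mat 1) (at_right 0)"
  proof -
    have "(S \<longlongrightarrow> udiag V (\<lambda>i. exp (- (0 / 2) * h i))) (at_right 0)"
      unfolding S_def by (intro tendsto_udiag tendsto_intros) auto
    then show ?thesis by (simp add: udiag_const[OF V])
  qed
  have St: "(S t)\<^sup>\<dagger> = S t" and Sinv: "S t ** S (- t) = mat 1" for t
    by (simp_all add: S_def udiag_mult[OF V] udiag_const[OF V] flip: exp_add)
  have "((\<lambda>t. hlog (S t ** A i ** S t)) \<longlongrightarrow> hlog (A i)) (at_right 0)" if "i \<in> I" for i
  proof (rule tendsto_hlog[OF A_pos[OF that]])
    have "pos_def (S t ** A i ** S t)" for t
      using pos_def_sandwich[OF A_pos[OF that] Sinv[of t]] by (simp add: St)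
    then show "\<forall>\<^sub>F t in at_right 0. pos_def (S t ** A i ** S t)" by simp
    have "((\<lambda>t. S t ** A i ** S t) \<longlongrightarrow> mat 1 ** A i ** mat 1) (at_right 0)"
      by (intro tendsto_matrix_mult S1 tendsto_const)
    then show "((\<lambda>t. S t ** A i ** S t) \<longlongrightarrow> A i) (at_right 0)" by simp
  qed
  then have "((\<lambda>t. log_sum (Y t)) \<longlongrightarrow> H) (at_right 0)"
    unfolding log_sum_def S H_def by (intro tendsto_sum tendsto_scaleR tendsto_const)
  then have "((\<lambda>t. log_sum (Y t) \<bullet> H) \<longlongrightarrow> H \<bullet> H) (at_right 0)"
    by (intro tendsto_inner tendsto_const)
  then have "H \<bullet> H \<le> 0"
    by (rule tendsto_upperbound) (auto simp: eventually_at_filter le)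
  then have "H \<bullet> H = 0" using inner_ge_zero[of H] by linarith
  then show ?thesis by (simp add: H_def)
qed

text \<open>A point farther than \<open>2 a\<close> from the identity is farther than \<open>a\<close> from every \<open>A i\<close>.\<close>

lemma cost_far:
  assumes a: "\<And>i. i \<in> I \<Longrightarrow> riem_dist (mat 1) (A i) \<le> a"
    and Y: "pos_def Y" "2 * a < riem_dist (mat 1) Y"
  shows "cost (mat 1) < cost Y"
proof -
  have "I \<noteq> {}" using w_sum by auto
  then have a0: "0 \<le> a" using a riem_dist_nonneg order.trans by blast
  define s where "s = riem_dist (mat 1) Y - a"
  have s: "a < s" using Y(2) by (simp add: s_def)
  have "s \<le> riem_dist Y (A i)" if "i \<in> I" for i
    using riem_dist_reverse_triangle[OF pos_def_one Y(1) A_pos[OF that]] a[OF that]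
    by (simp add: s_def)
  then have "(\<Sum>i\<in>I. w i * s\<^sup>2) \<le> cost Y"
    unfolding cost_def using s a0 by (intro sum_mono mult_left_mono power_mono w_nonneg) auto
  moreover have "cost (mat 1) \<le> (\<Sum>i\<in>I. w i * a\<^sup>2)"
    unfolding cost_def by (intro sum_mono mult_left_mono power_mono w_nonneg a) (auto simp: riem_dist_nonneg)
  moreover have "a\<^sup>2 < s\<^sup>2" using s a0 by (intro power_strict_mono) auto
  ultimately show ?thesis by (simp add: w_sum flip: sum_distrib_right)
qed

lemma exists_minimizer: "\<exists>X. pos_def X \<and> (\<forall>Y. pos_def Y \<longrightarrow> cost X \<le> cost Y)"
proof -
  define a where "a = (\<Sum>i\<in>I. riem_dist (mat 1) (A i))"
  have a: "riem_dist (mat 1) (A i) \<le> a" if "i \<in> I" for i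
    unfolding a_def using that finite_I by (intro member_le_sum) (auto simp: riem_dist_nonneg)
  have a0: "0 \<le> a" unfolding a_def by (intro sum_nonneg riem_dist_nonneg)
  have one: "mat 1 \<in> loewner_box (2 * a)"
    using a0 by (intro mem_loewner_box_of_riem_dist) (simp_all add: riem_dist_self)
  have "continuous_on {X. pos_def X} cost"
    unfolding cost_def by (intro continuous_intros continuous_on_riem_dist A_pos)
  then have "continuous_on (loewner_box (2 * a)) cost"
    by (rule continuous_on_subset) (use loewner_box_pos_def in blast)
  then obtain X where X: "X \<in> loewner_box (2 * a)" and min: "\<forall>Y\<in>loewner_box (2 * a). cost X \<le> cost Y"
    using continuous_attains_inf[OF compact_loewner_box] one by blast
  have "cost X \<le> cost Y" if Y: "pos_def Y" for Y
  proof (cases "riem_dist (mat 1) Y \<le> 2 * a")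
    case True
    then show ?thesis using min mem_loewner_box_of_riem_dist[OF Y] by blast
  next
    case False
    then have "cost (mat 1) < cost Y" using cost_far[OF a Y] by simp
    then show ?thesis using min one by fastforce
  qed
  then show ?thesis using X loewner_box_pos_def by blast
qed

lemma weighted_points_inv_sqrt_sandwich:
  assumes "pos_def X"
  shows "weighted_points I w (\<lambda>i. inv_sqrt X ** A i ** inv_sqrt X)"
  using finite_I w_nonneg w_sum pos_def_inv_sqrt_sandwich[OF assms A_pos] by unfold_locales auto

lemma log_sum_minimizer:
  assumes X: "pos_def X" and min: "\<And>Y. pos_def Y \<Longrightarrow> cost X \<le> cost Y"
  shows "log_sum X = 0"
proof -
  define R where "R = inv_sqrt X"
  obtain C where C: "C\<^sup>\<dagger> = C" "R\<^sup>\<dagger> = R" "C ** C = X" "C ** R = mat 1" "R ** C = mat 1"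
    using pos_def_sqrt[OF X] unfolding R_def by metis
  interpret B: weighted_points I w "\<lambda>i. R ** A i ** R"
    unfolding R_def by (rule weighted_points_inv_sqrt_sandwich[OF X])
  have cost: "B.cost (R ** Y ** R) = cost Y" if "pos_def Y" for Y
    unfolding B.cost_def unfolding cost_def R_def
    by (intro sum.cong refl) (simp add: riem_dist_inv_sqrt_sandwich[OF X that A_pos])
  have RXR: "R ** X ** R = mat 1" by (metis C matrix_mul_assoc matrix_mul_rid)
  have "(\<Sum>i\<in>I. w i *\<^sub>R hlog (R ** A i ** R)) = 0"
  proof (rule B.sum_hlog_eq_0_of_min_one)
    fix Y :: "complex^'n^'n" assume Y: "pos_def Y"
    define Y' where "Y' = C ** Y ** C"
    have Y': "pos_def Y'" using pos_def_sandwich[OF Y C(4)] by (simp add: Y'_def C)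
    have "R ** Y' ** R = (R ** C) ** Y ** (C ** R)"
      unfolding Y'_def by (simp only: matrix_mul_assoc)
    then have "R ** Y' ** R = Y" by (simp add: C)
    then show "B.cost (mat 1) \<le> B.cost Y"
      using min[OF Y'] cost[OF Y'] cost[OF X] RXR by simp
  qed
  then show ?thesis by (simp add: log_sum_def R_def)
qed

text \<open>The variance inequality. It contains the uniqueness of the minimizer and, applied to two
weight vectors, its stability.\<close>

lemma cost_ge_minimizer:
  assumes X: "pos_def X" and min: "\<And>Y. pos_def Y \<Longrightarrow> cost X \<le> cost Y" and Y: "pos_def Y"
  shows "cost X + (riem_dist X Y)\<^sup>2 \<le> cost Y"
  using cost_ge[OF X Y] by (simp add: log_sum_minimizer[OF X min])

definition bary :: "complex^'n^'n" where
  "bary = (THE X. is_arg_min cost pos_def X)"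

lemma bary_pos: "pos_def bary" and bary_min: "pos_def Y \<Longrightarrow> cost bary \<le> cost Y"
proof -
  obtain X where X: "pos_def X" and min: "\<And>Y. pos_def Y \<Longrightarrow> cost X \<le> cost Y"
    using exists_minimizer by blast
  have "bary = X"
    unfolding bary_def
  proof (rule the_equality)
    show "is_arg_min cost pos_def X" using X min by (auto simp: is_arg_min_def not_less)
    fix Y assume "is_arg_min cost pos_def Y"
    then have Y: "pos_def Y" "cost Y \<le> cost X" using X by (auto simp: is_arg_min_def not_less)
    have "(riem_dist X Y)\<^sup>2 \<le> 0" using cost_ge_minimizer[OF X min Y(1)] Y(2) by linarith
    then show "Y = X" using riem_dist_eq_0D[OF X Y(1)] by simp
  qed
  with X min show "pos_def bary" "pos_def Y \<Longrightarrow> cost bary \<le> cost Y" by auto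
qed

lemma riem_dist_one_bary_le:
  assumes "\<And>i. i \<in> I \<Longrightarrow> riem_dist (mat 1) (A i) \<le> a"
  shows "riem_dist (mat 1) bary \<le> 2 * a"
  using cost_far[OF assms bary_pos] bary_min[OF pos_def_one] by fastforce

text \<open>After moving the minimizer \<open>X\<close> to the identity the weighted logarithms of the points \<open>B i\<close> sum to
zero, so the logarithmic terms drop out of the weighted sums of the bounds
\<open>log B \<le> B - 1\<close> and \<open>- log B \<le> B\<^bsup>-1\<^esup> - 1\<close>. The second sum says \<open>X\<^bsup>-1\<^esup> \<le> T\<close> with
\<open>T = \<Sum> w\<^sub>i A\<^sub>i\<^bsup>-1\<^esup>\<close>. It is stated in the tangent form
\<open>2 Z - Z T Z \<le> X\<close>, which is affine in the weights; this holds because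
\<open>X - 2 Z + Z X\<^bsup>-1\<^esup> Z\<close> is the square \<open>(X\<^bsup>1/2\<^esup> - Z X\<^bsup>-1/2\<^esup>) (X\<^bsup>1/2\<^esup> - Z X\<^bsup>-1/2\<^esup>)\<^sup>\<dagger>\<close>.\<close>

lemma bary_le_arithmetic: "bary \<preceq>\<^sub>L (\<Sum>i\<in>I. w i *\<^sub>R A i)"
  and bary_ge_harmonic_tangent: "Z\<^sup>\<dagger> = Z \<Longrightarrow>
    2 *\<^sub>R Z - Z ** (\<Sum>i\<in>I. w i *\<^sub>R matrix_inv (A i)) ** Z \<preceq>\<^sub>L bary"
proof -
  define X where "X = bary"
  have X: "pos_def X" unfolding X_def by (rule bary_pos)
  define R where "R = inv_sqrt X"
  obtain C where C: "C\<^sup>\<dagger> = C" "R\<^sup>\<dagger> = R" "C ** C = X" "C ** R = mat 1" "R ** C = mat 1"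
    using pos_def_sqrt[OF X] unfolding R_def by metis
  have cancel: "C ** (R ** M ** R) ** C = M" "R ** (C ** M ** C) ** R = M" for M
  proof -
    have "C ** (R ** M ** R) ** C = (C ** R) ** M ** (R ** C)"
      "R ** (C ** M ** C) ** R = (R ** C) ** M ** (C ** R)" by (simp_all only: matrix_mul_assoc)
    then show "C ** (R ** M ** R) ** C = M" "R ** (C ** M ** C) ** R = M" by (simp_all add: C)
  qed
  define B where "B i = R ** A i ** R" for i
  have B: "pos_def (B i)" if "i \<in> I" for i
    unfolding B_def R_def by (rule pos_def_inv_sqrt_sandwich[OF X A_pos[OF that]])
  have log0: "(\<Sum>i\<in>I. w i *\<^sub>R hlog (B i)) = 0"
    using log_sum_minimizer[OF bary_pos bary_min] by (simp add: log_sum_def B_def R_def X_def)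
  have w1: "(\<Sum>i\<in>I. w i *\<^sub>R M) = M" for M :: "complex^'n^'n"
    by (simp add: w_sum flip: scaleR_sum_left)
  have "pos_semidef (\<Sum>i\<in>I. w i *\<^sub>R (B i - mat 1 - hlog (B i)))"
    by (intro pos_semidef_sum pos_semidef_scaleR hlog_le_minus_one B w_nonneg)
  then have "pos_semidef ((\<Sum>i\<in>I. w i *\<^sub>R B i) - mat 1)"
    by (simp add: scaleR_diff_right sum_subtractf log0 w1)
  then have "pos_semidef (C ** ((\<Sum>i\<in>I. w i *\<^sub>R B i) - mat 1) ** C\<^sup>\<dagger>)"
    by (rule pos_semidef_sandwich)
  also have "C ** ((\<Sum>i\<in>I. w i *\<^sub>R B i) - mat 1) ** C\<^sup>\<dagger> = (\<Sum>i\<in>I. w i *\<^sub>R A i) - X"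
    by (simp add: mult_diff_left mult_diff_right C sandwich_sum scaleR_mult_left scaleR_mult_right
        B_def cancel)
  finally show "bary \<preceq>\<^sub>L (\<Sum>i\<in>I. w i *\<^sub>R A i)" by (simp add: loewner_le_def X_def)

  define T where "T = (\<Sum>i\<in>I. w i *\<^sub>R matrix_inv (A i))"
  have Binv: "matrix_inv (B i) = C ** matrix_inv (A i) ** C" if "i \<in> I" for i
  proof (rule matrix_inv_eqI)
    have "B i ** (C ** matrix_inv (A i) ** C) = R ** (A i ** (R ** C) ** matrix_inv (A i)) ** C"
      unfolding B_def by (simp only: matrix_mul_assoc)
    also have "\<dots> = mat 1" by (simp add: C pos_def_matrix_inv[OF A_pos[OF that]])
    finally show "B i ** (C ** matrix_inv (A i) ** C) = mat 1" .
  qed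
  have "pos_semidef (\<Sum>i\<in>I. w i *\<^sub>R (matrix_inv (B i) - mat 1 + hlog (B i)))"
    by (intro pos_semidef_sum pos_semidef_scaleR minus_hlog_le_inv_minus_one B w_nonneg)
  then have "pos_semidef ((\<Sum>i\<in>I. w i *\<^sub>R matrix_inv (B i)) - mat 1)"
    by (simp add: scaleR_diff_right scaleR_add_right sum.distrib sum_subtractf log0 w1)
  then have "pos_semidef (R ** ((\<Sum>i\<in>I. w i *\<^sub>R matrix_inv (B i)) - mat 1) ** R\<^sup>\<dagger>)"
    by (rule pos_semidef_sandwich)
  also have "R ** ((\<Sum>i\<in>I. w i *\<^sub>R matrix_inv (B i)) - mat 1) ** R\<^sup>\<dagger> = T - R ** R"
    by (simp add: mult_diff_left mult_diff_right C sandwich_sum scaleR_mult_left scaleR_mult_right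
        Binv cancel T_def)
  finally have psd: "pos_semidef (T - R ** R)" .
  assume Z: "Z\<^sup>\<dagger> = Z"
  have "pos_semidef ((C - Z ** R) ** mat 1 ** (C - Z ** R)\<^sup>\<dagger> + Z ** (T - R ** R) ** Z\<^sup>\<dagger>)"
    by (intro pos_semidef_add pos_semidef_sandwich psd pos_def_imp_pos_semidef pos_def_one)
  moreover have "(C - Z ** R) ** mat 1 ** (C - Z ** R)\<^sup>\<dagger> + Z ** (T - R ** R) ** Z\<^sup>\<dagger>
      = X - (2 *\<^sub>R Z - Z ** T ** Z)"
  proof -
    have "(C - Z ** R) ** (C - R ** Z) = C ** C - (C ** R) ** Z - Z ** (R ** C) + Z ** (R ** R) ** Z"
      by (simp add: mult_diff_left mult_diff_right matrix_mul_assoc algebra_simps)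
    also have "\<dots> = X - 2 *\<^sub>R Z + Z ** (R ** R) ** Z"
      by (simp add: C scaleR_2)
    finally have square: "(C - Z ** R) ** (C - R ** Z) = X - 2 *\<^sub>R Z + Z ** (R ** R) ** Z" .
    have "(C - Z ** R)\<^sup>\<dagger> = C - R ** Z"
      by (simp add: conj_transpose_diff conj_transpose_mult C Z)
    then show ?thesis
      unfolding matrix_mul_rid Z by (simp only: square) (simp add: mult_diff_left mult_diff_right)
  qed
  ultimately show "2 *\<^sub>R Z - Z ** T ** Z \<preceq>\<^sub>L bary"
    by (simp add: loewner_le_def X_def)
qed

end

section \<open>Integrating over the weights\<close>

text \<open>Both barycentres minimize their own cost. Adding the variance inequality of the first to the
minimality of the second leaves a difference of costs that is linear in \<open>w - v\<close>.\<close>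

lemma riem_dist_bary_sq_le:
  assumes w: "weighted_points I w A" and v: "weighted_points I v A"
    and a: "\<And>i. i \<in> I \<Longrightarrow> riem_dist (mat 1) (A i) \<le> a"
  shows "(riem_dist (weighted_points.bary I w A) (weighted_points.bary I v A))\<^sup>2
    \<le> (3 * a)\<^sup>2 * (\<Sum>i\<in>I. \<bar>w i - v i\<bar>)"
proof -
  interpret w: weighted_points I w A by (rule w)
  interpret v: weighted_points I v A by (rule v)
  have far: "(riem_dist X (A i))\<^sup>2 \<in> {0..(3 * a)\<^sup>2}"
    if "i \<in> I" "pos_def X" "riem_dist (mat 1) X \<le> 2 * a" for X i
  proof -
    have "riem_dist X (A i) \<le> 3 * a"
      using riem_dist_reverse_triangle[OF that(2) w.A_pos[OF that(1)] pos_def_one]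
        riem_dist_commute[OF that(2) pos_def_one] riem_dist_commute[OF w.A_pos[OF that(1)] pos_def_one]
        a[OF that(1)] that(3) by linarith
    then have "(riem_dist X (A i))\<^sup>2 \<le> (3 * a)\<^sup>2" by (intro power_mono riem_dist_nonneg)
    then show ?thesis by simp
  qed
  have wb: "riem_dist (mat 1) w.bary \<le> 2 * a" and vb: "riem_dist (mat 1) v.bary \<le> 2 * a"
    by (rule w.riem_dist_one_bary_le v.riem_dist_one_bary_le, rule a, assumption)+
  have "(riem_dist w.bary v.bary)\<^sup>2
      \<le> (w.cost v.bary - w.cost w.bary) - (v.cost v.bary - v.cost w.bary)"
    using w.cost_ge_minimizer[OF w.bary_pos w.bary_min v.bary_pos] v.bary_min[OF w.bary_pos] by linarith
  also have "\<dots> = (\<Sum>i\<in>I. (w i - v i) * ((riem_dist v.bary (A i))\<^sup>2 - (riem_dist w.bary (A i))\<^sup>2))"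
    by (simp add: w.cost_def v.cost_def algebra_simps flip: sum_subtractf sum.distrib)
  also have "\<dots> \<le> (\<Sum>i\<in>I. \<bar>w i - v i\<bar> * (3 * a)\<^sup>2)"
  proof (rule sum_mono)
    fix i assume i: "i \<in> I"
    have "\<bar>(riem_dist v.bary (A i))\<^sup>2 - (riem_dist w.bary (A i))\<^sup>2\<bar> \<le> (3 * a)\<^sup>2"
      using far[OF i v.bary_pos vb] far[OF i w.bary_pos wb]
      by (simp only: atLeastAtMost_iff abs_le_iff) linarith
    then have "\<bar>(w i - v i) * ((riem_dist v.bary (A i))\<^sup>2 - (riem_dist w.bary (A i))\<^sup>2)\<bar>
        \<le> \<bar>w i - v i\<bar> * (3 * a)\<^sup>2"
      unfolding abs_mult by (rule mult_left_mono) simp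
    then show "(w i - v i) * ((riem_dist v.bary (A i))\<^sup>2 - (riem_dist w.bary (A i))\<^sup>2)
        \<le> \<bar>w i - v i\<bar> * (3 * a)\<^sup>2" by linarith
  qed
  also have "\<dots> = (3 * a)\<^sup>2 * (\<Sum>i\<in>I. \<bar>w i - v i\<bar>)"
    by (subst sum_distrib_right[symmetric]) (rule mult.commute)
  finally show ?thesis .
qed

text \<open>Unlike the members of \<open>prob_simplex\<close> these weights are arbitrary outside \<open>I\<close>, so that continuity in
them can be expressed with the product topology of the whole function space.\<close>

definition weight_set :: "'i set \<Rightarrow> ('i \<Rightarrow> real) set" where
  "weight_set I = {w. (\<forall>i\<in>I. 0 \<le> w i) \<and> sum w I = 1}"

lemma continuous_on_bary:
  assumes I: "finite I" and A: "\<And>i. i \<in> I \<Longrightarrow> pos_def (A i)"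
  shows "continuous_on (weight_set I) (\<lambda>w. weighted_points.bary I w A)"
  unfolding continuous_on_def
proof
  fix w assume "w \<in> weight_set I"
  have wp: "weighted_points I v A" if "v \<in> weight_set I" for v
    using I A that by unfold_locales (auto simp: weight_set_def)
  note w = wp[OF \<open>w \<in> weight_set I\<close>]
  define a where "a = (\<Sum>i\<in>I. riem_dist (mat 1) (A i))"
  have a: "riem_dist (mat 1) (A i) \<le> a" if "i \<in> I" for i
    unfolding a_def using that I by (intro member_le_sum) (auto simp: riem_dist_nonneg)
  let ?F = "at w within weight_set I"
  let ?G = "\<lambda>v. weighted_points.bary I v A"
  have ev: "\<forall>\<^sub>F v in ?F. v \<in> weight_set I" by (simp add: eventually_at_filter)
  have "continuous_on UNIV (\<lambda>v. (3 * a)\<^sup>2 * (\<Sum>i\<in>I. \<bar>w i - v i\<bar>))"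
    by (intro continuous_intros continuous_on_product_coordinates)
  then have "((\<lambda>v. (3 * a)\<^sup>2 * (\<Sum>i\<in>I. \<bar>w i - v i\<bar>)) \<longlongrightarrow> (3 * a)\<^sup>2 * (\<Sum>i\<in>I. \<bar>w i - w i\<bar>)) ?F"
    unfolding continuous_on_def using tendsto_mono[OF at_le[of _ UNIV]] by blast
  then have lim: "((\<lambda>v. sqrt ((3 * a)\<^sup>2 * (\<Sum>i\<in>I. \<bar>w i - v i\<bar>))) \<longlongrightarrow> 0) ?F"
    using tendsto_real_sqrt by fastforce
  have "\<forall>\<^sub>F v in ?F. norm (riem_dist (?G w) (?G v)) \<le> sqrt ((3 * a)\<^sup>2 * (\<Sum>i\<in>I. \<bar>w i - v i\<bar>))"
    using ev
  proof eventually_elim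
    case (elim v)
    show ?case
      using riem_dist_bary_sq_le[OF w wp[OF elim] a] by (auto simp: riem_dist_nonneg intro: real_le_rsqrt)
  qed
  then have dist0: "((\<lambda>v. riem_dist (?G w) (?G v)) \<longlongrightarrow> 0) ?F"
    using lim by (rule Lim_null_comparison)
  have "\<forall>\<^sub>F v in ?F. pos_def (?G v)"
    using ev by eventually_elim (rule weighted_points.bary_pos[OF wp])
  then show "(?G \<longlongrightarrow> ?G w) ?F"
    by (rule riem_dist_tendsto_0D[OF weighted_points.bary_pos[OF w] _ dist0])
qed

lemma (in weighted_points) pos_def_weighted_sum: "pos_def (\<Sum>i\<in>I. w i *\<^sub>R A i)"
  unfolding pos_def_def
proof (intro conjI allI impI)
  show "hermitian (\<Sum>i\<in>I. w i *\<^sub>R A i)"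
    using A_pos by (simp add: hermitian_def pos_def_def conj_transpose_scaleR
        linear_sum[OF bounded_linear.linear[OF bounded_linear_conj_transpose]])
  fix x :: "complex^'n" assume x: "x \<noteq> 0"
  have "\<exists>i\<in>I. 0 < w i"
  proof (rule ccontr)
    assume "\<not> ?thesis"
    then have "sum w I = 0" using w_nonneg by (intro sum.neutral) force
    then show False by (simp add: w_sum)
  qed
  then obtain i where i: "i \<in> I" "0 < w i" by blast
  have q: "0 < Re (quad_form (A i) x)" if "i \<in> I" for i
    using A_pos[OF that] x by (simp add: pos_def_def)
  have lin: "linear (\<lambda>M :: complex^'n^'n. Re (quad_form M x))"
    by (rule bounded_linear.linear[OF bounded_linear_Re_quad_form])
  have "0 < (\<Sum>i\<in>I. w i * Re (quad_form (A i) x))"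
    using i q w_nonneg by (intro sum_pos2[OF finite_I i(1)]) (auto simp: less_imp_le)
  then show "0 < Re (quad_form (\<Sum>i\<in>I. w i *\<^sub>R A i) x)"
    by (simp add: linear_sum[OF lin] linear_scale[OF lin])
qed

lemma pos_semidef_integral:
  fixes f :: "'a \<Rightarrow> complex^'n^'n"
  assumes f: "integrable M f" and psd: "\<And>x. x \<in> space M \<Longrightarrow> pos_semidef (f x)"
  shows "pos_semidef (\<integral>x. f x \<partial>M)"
  unfolding pos_semidef_def hermitian_def
proof (intro conjI allI)
  have "(\<integral>x. f x \<partial>M)\<^sup>\<dagger> = (\<integral>x. (f x)\<^sup>\<dagger> \<partial>M)"
    by (rule integral_bounded_linear[OF bounded_linear_conj_transpose f, symmetric])
  also have "\<dots> = (\<integral>x. f x \<partial>M)"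
    by (rule Bochner_Integration.integral_cong) (use psd in \<open>auto simp: pos_semidef_def hermitian_def\<close>)
  finally show "(\<integral>x. f x \<partial>M)\<^sup>\<dagger> = (\<integral>x. f x \<partial>M)" .
  fix y
  have "0 \<le> (\<integral>x. Re (quad_form (f x) y) \<partial>M)"
    by (rule Bochner_Integration.integral_nonneg) (use psd in \<open>auto simp: pos_semidef_def\<close>)
  then show "0 \<le> Re (quad_form (\<integral>x. f x \<partial>M) y)"
    using integral_bounded_linear[OF bounded_linear_Re_quad_form f, of y] by simp
qed

lemma weighted_points_simplex:
  assumes "w \<in> prob_simplex m" "\<And>i. i \<in> {1..m} \<Longrightarrow> pos_def (A i)"
  shows "weighted_points {1..m} w A"
  using assms by unfold_locales (auto simp: prob_simplex_def PiE_iff)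

lemma geo_mean_eq_bary:
  assumes "weighted_points {1..m} w A"
  shows "geo_mean m w A = weighted_points.bary {1..m} w A"
  unfolding geo_mean_def weighted_points.bary_def[OF assms] weighted_points.cost_def[OF assms, abs_def] ..

lemma space_borel_simplex: "space (borel_simplex m) = prob_simplex m"
proof -
  have "prob_simplex m \<subseteq> space (\<Pi>\<^sub>M i\<in>{1..m}. borel)"
    by (auto simp: space_PiM prob_simplex_def PiE_def)
  then show ?thesis by (auto simp: borel_simplex_def space_restrict_space)
qed

text \<open>For \<open>i\<close> outside \<open>{1..m}\<close> the coordinate is the constant \<open>undefined\<close>. With all coordinates measurable,
the identity maps the simplex measurably into the Borel space of the product topology, where
continuity of the mean can be used.\<close>

lemma measurable_weight: "(\<lambda>w. w i) \<in> borel_measurable (borel_simplex m)"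
proof (cases "i \<in> {1..m}")
  case True
  then show ?thesis
    unfolding borel_simplex_def by (intro measurable_restrict_space1 measurable_component_singleton)
next
  case False
  have "(\<lambda>w. undefined :: real) \<in> borel_measurable (borel_simplex m)" by simp
  also have "?this \<longleftrightarrow> ?thesis"
    by (rule measurable_cong) (use False in \<open>auto simp: space_borel_simplex prob_simplex_def PiE_iff extensional_def\<close>)
  finally show ?thesis .
qed

lemma measurable_geo_mean:
  assumes A: "\<And>i. i \<in> {1..m} \<Longrightarrow> pos_def (A i)"
  shows "(\<lambda>w. geo_mean m w A) \<in> borel_measurable (borel_simplex m)"
proof -
  let ?G = "\<lambda>w. weighted_points.bary {1..m} w A"
  have eq: "geo_mean m w A = ?G w" if "w \<in> prob_simplex m" for w
    using that by (intro geo_mean_eq_bary weighted_points_simplex A)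
  have "?G \<in> borel_measurable (restrict_space borel (weight_set {1..m}))"
    by (intro borel_measurable_continuous_on_restrict continuous_on_bary A finite_atLeastAtMost)
  moreover have "(\<lambda>w. w) \<in> borel_simplex m \<rightarrow>\<^sub>M restrict_space borel (weight_set {1..m})"
  proof (rule measurable_restrict_space2)
    show "(\<lambda>w. w) \<in> space (borel_simplex m) \<rightarrow> weight_set {1..m}"
      by (auto simp: space_borel_simplex prob_simplex_def weight_set_def PiE_iff)
    show "(\<lambda>w. w) \<in> borel_measurable (borel_simplex m)"
      by (intro measurable_coordinatewise_then_product measurable_weight)
  qed
  ultimately have "(\<lambda>w. ?G w) \<in> borel_measurable (borel_simplex m)"
    by (rule measurable_compose[rotated])
  also have "?this \<longleftrightarrow> ?thesis"
    by (rule measurable_cong)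
       (simp only: space_borel_simplex eq)
  finally show ?thesis .
qed

locale simplex_distribution = prob_space \<nu> for \<nu> :: "(nat \<Rightarrow> real) measure" +
  fixes m :: nat
  assumes sets_eq: "sets \<nu> = sets (borel_simplex m)"
begin

lemma space_eq: "space \<nu> = prob_simplex m"
  using sets_eq_imp_space_eq[OF sets_eq] by (simp add: space_borel_simplex)

lemma integrable_weight:
  assumes "i \<in> {1..m}"
  shows "integrable \<nu> (\<lambda>w. w i)"
proof (rule integrable_const_bound[of _ 1])
  show "AE w in \<nu>. norm (w i) \<le> 1"
  proof (rule AE_I2)
    fix w assume "w \<in> space \<nu>"
    then have w: "\<And>i. i \<in> {1..m} \<Longrightarrow> 0 \<le> w i" "sum w {1..m} = 1"
      by (auto simp: space_eq prob_simplex_def PiE_iff)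
    have "w i \<le> sum w {1..m}" using assms w(1) by (intro member_le_sum) auto
    then show "norm (w i) \<le> 1" using w assms by simp
  qed
  show "(\<lambda>w. w i) \<in> borel_measurable \<nu>"
    unfolding measurable_cong_sets[OF sets_eq refl] by (rule measurable_weight)
qed

lemma mean_weight_nonneg: "i \<in> {1..m} \<Longrightarrow> 0 \<le> (\<integral>w. w i \<partial>\<nu>)"
  by (rule Bochner_Integration.integral_nonneg) (auto simp: space_eq prob_simplex_def PiE_iff)

lemma sum_mean_weight: "(\<Sum>i=1..m. \<integral>w. w i \<partial>\<nu>) = 1"
proof -
  have "(\<Sum>i=1..m. \<integral>w. w i \<partial>\<nu>) = (\<integral>w. (\<Sum>i=1..m. w i) \<partial>\<nu>)"
    by (rule Bochner_Integration.integral_sum[symmetric]) (rule integrable_weight)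
  also have "\<dots> = (\<integral>w. 1 \<partial>\<nu>)"
    by (rule Bochner_Integration.integral_cong) (auto simp: space_eq prob_simplex_def)
  finally show ?thesis by (simp add: prob_space)
qed

lemma has_mean_weighted_sum:
  fixes B :: "nat \<Rightarrow> complex^'n^'n"
  shows "integrable \<nu> (\<lambda>w. \<Sum>i=1..m. w i *\<^sub>R B i)"
    and "(\<integral>w. (\<Sum>i=1..m. w i *\<^sub>R B i) \<partial>\<nu>) = (\<Sum>i=1..m. (\<integral>w. w i \<partial>\<nu>) *\<^sub>R B i)"
proof -
  have int: "integrable \<nu> (\<lambda>w. w i *\<^sub>R B i)" if "i \<in> {1..m}" for i
    using integrable_weight[OF that] by simp
  then show "integrable \<nu> (\<lambda>w. \<Sum>i=1..m. w i *\<^sub>R B i)" by (rule Bochner_Integration.integrable_sum)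
  show "(\<integral>w. (\<Sum>i=1..m. w i *\<^sub>R B i) \<partial>\<nu>) = (\<Sum>i=1..m. (\<integral>w. w i \<partial>\<nu>) *\<^sub>R B i)"
    by (subst Bochner_Integration.integral_sum[OF int])
       (auto intro!: sum.cong integral_scaleR_left integrable_weight)
qed

lemma integrable_geo_mean:
  fixes A :: "nat \<Rightarrow> complex^'n^'n"
  assumes A: "\<And>i. i \<in> {1..m} \<Longrightarrow> pos_def (A i)"
  shows "integrable \<nu> (\<lambda>w. geo_mean m w A)"
proof -
  define a where "a = (\<Sum>i=1..m. riem_dist (mat 1) (A i))"
  have a: "riem_dist (mat 1) (A i) \<le> a" if "i \<in> {1..m}" for i
    unfolding a_def using that by (intro member_le_sum) (auto simp: riem_dist_nonneg)
  show ?thesis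
  proof (rule integrable_const_bound[of _ "sqrt (real CARD('n)) * exp (2 * a)"])
    show "AE w in \<nu>. norm (geo_mean m w A) \<le> sqrt (real CARD('n)) * exp (2 * a)"
    proof (rule AE_I2)
      fix w assume "w \<in> space \<nu>"
      then have "weighted_points {1..m} w A" by (intro weighted_points_simplex A) (simp add: space_eq)
      then interpret weighted_points "{1..m}" w A .
      have "bary \<in> loewner_box (2 * a)"
        by (intro mem_loewner_box_of_riem_dist bary_pos riem_dist_one_bary_le a)
      then show "norm (geo_mean m w A) \<le> sqrt (real CARD('n)) * exp (2 * a)"
        unfolding geo_mean_eq_bary[OF weighted_points_axioms] by (rule norm_loewner_box_le)
    qed
    show "(\<lambda>w. geo_mean m w A) \<in> borel_measurable \<nu>"
      unfolding measurable_cong_sets[OF sets_eq refl] by (rule measurable_geo_mean) (rule A)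
  qed
qed

text \<open>The lower bound is Jensen's inequality for the operator convex inversion: the tangent at
\<open>Y = \<Sum> wbar\<^sub>i A\<^sub>i\<^bsup>-1\<^esup>\<close>, where \<open>Z = Y\<^bsup>-1\<^esup>\<close>, is affine in the weights, and its mean is
\<open>2 Z - Z Y Z = Z\<close>.\<close>

theorem geodesic_mean_bounds:
  fixes A :: "nat \<Rightarrow> complex^'n^'n"
  assumes A: "\<And>i. i \<in> {1..m} \<Longrightarrow> pos_def (A i)"
  shows "matrix_inv (\<Sum>i=1..m. (\<integral>w. w i \<partial>\<nu>) *\<^sub>R matrix_inv (A i)) \<preceq>\<^sub>L geodesic_mean m \<nu> A"
    and "geodesic_mean m \<nu> A \<preceq>\<^sub>L (\<Sum>i=1..m. (\<integral>w. w i \<partial>\<nu>) *\<^sub>R A i)"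
proof -
  note int = has_mean_weighted_sum integrable_geo_mean[OF A]
  have wp: "weighted_points {1..m} w A" if "w \<in> space \<nu>" for w
    using that by (intro weighted_points_simplex A) (simp add: space_eq)
  have upper: "pos_semidef ((\<Sum>i=1..m. w i *\<^sub>R A i) - geo_mean m w A)" if "w \<in> space \<nu>" for w
    using weighted_points.bary_le_arithmetic[OF wp[OF that]]
    unfolding loewner_le_def geo_mean_eq_bary[OF wp[OF that]] .
  have "pos_semidef (\<integral>w. (\<Sum>i=1..m. w i *\<^sub>R A i) - geo_mean m w A \<partial>\<nu>)"
    by (intro pos_semidef_integral Bochner_Integration.integrable_diff int upper)
  then show "geodesic_mean m \<nu> A \<preceq>\<^sub>L (\<Sum>i=1..m. (\<integral>w. w i \<partial>\<nu>) *\<^sub>R A i)"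
    by (simp only: loewner_le_def geodesic_mean_def Bochner_Integration.integral_diff[OF int(1,3)] int(2))

  define Y where "Y = (\<Sum>i=1..m. (\<integral>w. w i \<partial>\<nu>) *\<^sub>R matrix_inv (A i))"
  define Z where "Z = matrix_inv Y"
  have "weighted_points {1..m} (\<lambda>i. \<integral>w. w i \<partial>\<nu>) (\<lambda>i. matrix_inv (A i))"
    by (intro weighted_points.intro finite_atLeastAtMost mean_weight_nonneg sum_mean_weight
        pos_def_matrix_inv(1) A)
  then have "pos_def Y" unfolding Y_def by (rule weighted_points.pos_def_weighted_sum)
  then have Z: "Z\<^sup>\<dagger> = Z" "Z ** Y = mat 1"
    using pos_def_matrix_inv[of Y] by (auto simp: Z_def pos_def_def hermitian_def)
  let ?T = "\<lambda>w. Z ** (\<Sum>i=1..m. w i *\<^sub>R matrix_inv (A i)) ** Z"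
  have T1: "integrable \<nu> ?T"
    by (rule integrable_bounded_linear[OF bounded_linear_sandwich int(1)])
  have "(\<integral>w. ?T w \<partial>\<nu>) = Z ** Y ** Z"
    unfolding integral_bounded_linear[OF bounded_linear_sandwich int(1)] int(2) Y_def ..
  then have T2: "(\<integral>w. ?T w \<partial>\<nu>) = Z" by (simp add: Z)
  have lower: "pos_semidef (geo_mean m w A - (2 *\<^sub>R Z - ?T w))" if "w \<in> space \<nu>" for w
    using weighted_points.bary_ge_harmonic_tangent[OF wp[OF that] Z(1)]
    unfolding loewner_le_def geo_mean_eq_bary[OF wp[OF that]] .
  have "pos_semidef (\<integral>w. geo_mean m w A - (2 *\<^sub>R Z - ?T w) \<partial>\<nu>)"
    by (intro pos_semidef_integral Bochner_Integration.integrable_diff int integrable_const T1 lower)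
  also have "(\<integral>w. geo_mean m w A - (2 *\<^sub>R Z - ?T w) \<partial>\<nu>) = geodesic_mean m \<nu> A - (2 *\<^sub>R Z - Z)"
  proof -
    have "(\<integral>w. geo_mean m w A - (2 *\<^sub>R Z - ?T w) \<partial>\<nu>)
        = geodesic_mean m \<nu> A - ((\<integral>w. 2 *\<^sub>R Z \<partial>\<nu>) - (\<integral>w. ?T w \<partial>\<nu>))"
      unfolding geodesic_mean_def
      by (intro Bochner_Integration.integral_diff[THEN trans] arg_cong2[of _ _ _ _ minus] refl
          Bochner_Integration.integrable_diff int integrable_const T1)
    then show ?thesis by (simp only: T2) (simp add: prob_space)
  qed
  finally show "matrix_inv (\<Sum>i=1..m. (\<integral>w. w i \<partial>\<nu>) *\<^sub>R matrix_inv (A i)) \<preceq>\<^sub>L geodesic_mean m \<nu> A"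
    by (simp add: loewner_le_def Z_def Y_def scaleR_2)
qed

end

section \<open>The uniform distribution on the simplex\<close>

lemma measurable_corner_simplex:
  fixes J :: "'a set"
  assumes "finite J"
  shows "{x. (\<forall>i\<in>J. 0 \<le> x i) \<and> sum x J \<le> t} \<inter> space (\<Pi>\<^sub>M i\<in>J. lborel)
    \<in> sets (\<Pi>\<^sub>M i\<in>J. (lborel :: real measure))"
proof -
  have "{x. (\<forall>i\<in>J. 0 \<le> x i) \<and> sum x J \<le> t} \<inter> space (\<Pi>\<^sub>M i\<in>J. lborel) =
      Pi\<^sub>E J (\<lambda>_. {0..}) \<inter> (\<lambda>x. sum x J) -` {..t} \<inter> space (\<Pi>\<^sub>M i\<in>J. lborel)"
    by (auto simp: space_PiM)
  also have "\<dots> \<in> sets (\<Pi>\<^sub>M i\<in>J. (lborel :: real measure))"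
    using assms by measurable
  finally show ?thesis .
qed

text \<open>Slicing by the value \<open>y\<close> of the coordinate \<open>i\<close>: the slice is a corner simplex of size \<open>1 - y\<close>, with
volume \<open>(1 - y)\<^sup>k / k!\<close> for \<open>k = card J\<close>. What remains is the Beta integral of \<open>y (1 - y)\<^sup>k\<close>.\<close>

lemma nn_integral_coordinate_corner_simplex:
  fixes J :: "'a set"
  assumes J: "finite J" and i: "i \<notin> J"
  shows "(\<integral>\<^sup>+x. ennreal (x i) * indicator ({x. (\<forall>j\<in>insert i J. 0 \<le> x j) \<and> sum x (insert i J) \<le> 1}) x
      \<partial>(\<Pi>\<^sub>M j\<in>insert i J. lborel)) = ennreal (1 / fact (card J + 2))"
proof -
  interpret product_sigma_finite "\<lambda>_ :: 'a. lborel :: real measure" by standard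
  define S where "S K t = {x :: 'a \<Rightarrow> real. (\<forall>j\<in>K. 0 \<le> x j) \<and> sum x K \<le> t}" for K t
  let ?M = "\<lambda>K. \<Pi>\<^sub>M j\<in>K. (lborel :: real measure)"
  define k where "k = card J"
  have meas: "S K t \<inter> space (?M K) \<in> sets (?M K)" if "finite K" for K t
    unfolding S_def by (rule measurable_corner_simplex[OF that])
  have upd: "x(i := y) \<in> S (insert i J) 1 \<longleftrightarrow> y \<in> {0..1} \<and> x \<in> S J (1 - y)" for x y
    unfolding S_def by (rule emeasure_std_simplex_aux_step[OF i J])
  have "(\<integral>\<^sup>+x. ennreal (x i) * indicator (S (insert i J) 1) x \<partial>?M (insert i J))
      = (\<integral>\<^sup>+x. ennreal (x i) * indicator (S (insert i J) 1 \<inter> space (?M (insert i J))) x \<partial>?M (insert i J))"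
    by (intro nn_integral_cong) (simp add: indicator_def)
  also have "\<dots> = (\<integral>\<^sup>+y. \<integral>\<^sup>+x. ennreal ((x(i := y)) i)
      * indicator (S (insert i J) 1 \<inter> space (?M (insert i J))) (x(i := y)) \<partial>?M J \<partial>lborel)"
    using J i meas[of "insert i J"] by (intro product_nn_integral_insert_rev) auto
  also have "\<dots> = (\<integral>\<^sup>+y. \<integral>\<^sup>+x. (ennreal y * indicator {0..1} y) * indicator (S J (1 - y) \<inter> space (?M J)) x
      \<partial>?M J \<partial>lborel)"
    using upd i by (intro nn_integral_cong)
      (auto simp: indicator_def space_PiM PiE_def extensional_def)
  also have "\<dots> = (\<integral>\<^sup>+y. (ennreal y * indicator {0..1} y) * emeasure (?M J) (S J (1 - y) \<inter> space (?M J)) \<partial>lborel)"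
    using meas[OF J] by (simp add: nn_integral_cmult)
  also have "\<dots> = (\<integral>\<^sup>+y\<in>{0..1}. ennreal (y * (1 - y) ^ k / fact k) \<partial>lborel)"
    unfolding S_def by (intro nn_integral_cong)
      (auto simp: indicator_def emeasure_std_simplex_aux[OF J] k_def simp flip: ennreal_mult)
  also have "\<dots> = ennreal (1 / fact (k + 2))"
  proof -
    \<comment> \<open>An antiderivative of \<open>y (1 - y)\<^sup>k = (1 - y)\<^sup>k - (1 - y)\<^sup>k\<^sup>+\<^sup>1\<close>, divided by \<open>k!\<close>.\<close>
    let ?F = "\<lambda>y :: real. ((1 - y) ^ Suc (Suc k) / Suc (Suc k) - (1 - y) ^ Suc k / Suc k) / fact k"
    have power: "((\<lambda>y. (1 - y) ^ Suc n / Suc n) has_real_derivative (- ((1 - y) ^ n))) (at y)"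
      for n and y :: real
      by (rule derivative_eq_intros refl | simp)+
    have "(\<integral>\<^sup>+y\<in>{0..1}. ennreal (y * (1 - y) ^ k / fact k) \<partial>lborel) = ennreal (?F 1 - ?F 0)"
    proof (rule nn_integral_FTC_Icc)
      fix y :: real
      have "(?F has_real_derivative ((- ((1 - y) ^ Suc k)) - (- ((1 - y) ^ k))) / fact k) (at y)"
        by (intro DERIV_cdivide DERIV_diff power)
      then show "(?F has_real_derivative y * (1 - y) ^ k / fact k) (at y)"
        by (simp add: algebra_simps)
    qed auto
    also have "?F 1 - ?F 0 = 1 / fact (k + 2)"
      by (simp add: field_simps)
    finally show ?thesis .
  qed
  finally show ?thesis by (simp add: S_def k_def)
qed

definition corner_measure :: "nat \<Rightarrow> (nat \<Rightarrow> real) measure" where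
  "corner_measure m = restrict_space (\<Pi>\<^sub>M i\<in>{1..<m}. lborel) (corner_simplex m)"

lemma corner_simplex_eq:
  "corner_simplex m
    = {u. (\<forall>i\<in>{1..<m}. 0 \<le> u i) \<and> sum u {1..<m} \<le> 1} \<inter> space (\<Pi>\<^sub>M i\<in>{1..<m}. (lborel :: real measure))"
  by (auto simp: corner_simplex_def space_PiM PiE_def)

lemma corner_simplex_sets: "corner_simplex m \<in> sets (\<Pi>\<^sub>M i\<in>{1..<m}. (lborel :: real measure))"
  unfolding corner_simplex_eq by (rule measurable_corner_simplex) simp

lemma space_corner_measure: "space (corner_measure m) = corner_simplex m"
  using sets.sets_into_space[OF corner_simplex_sets[of m]]
  by (auto simp: corner_measure_def space_restrict_space)

lemma emeasure_corner_measure: "emeasure (corner_measure m) (corner_simplex m) = ennreal (1 / fact (m - 1))"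
proof -
  have "emeasure (corner_measure m) (corner_simplex m)
      = emeasure (\<Pi>\<^sub>M i\<in>{1..<m}. (lborel :: real measure)) (corner_simplex m)"
    unfolding corner_measure_def
    using sets.sets_into_space[OF corner_simplex_sets[of m]] corner_simplex_sets[of m]
    by (intro emeasure_restrict_space) (auto simp: Int_absorb2)
  also have "\<dots> = ennreal (1 / fact (m - 1))"
    unfolding corner_simplex_eq by (subst emeasure_std_simplex_aux) auto
  finally show ?thesis .
qed

lemma measurable_last_weight:
  assumes "m \<ge> 1"
  shows "(\<lambda>u. u(m := 1 - (\<Sum>i = 1..<m. u i))) \<in> corner_measure m \<rightarrow>\<^sub>M borel_simplex m"
  unfolding borel_simplex_def
proof (rule measurable_restrict_space2)
  have m: "{1..m} = insert m {1..<m}" using assms by auto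
  show "(\<lambda>u. u(m := 1 - (\<Sum>i = 1..<m. u i))) \<in> space (corner_measure m) \<rightarrow> prob_simplex m"
  proof
    fix u assume "u \<in> space (corner_measure m)"
    then have u: "\<forall>i\<in>{1..<m}. 0 \<le> u i" "sum u {1..<m} \<le> 1" "u \<in> extensional {1..<m}"
      by (auto simp: space_corner_measure corner_simplex_def PiE_iff)
    have "sum (u(m := 1 - sum u {1..<m})) {1..<m} = sum u {1..<m}"
      by (intro sum.cong) auto
    then show "u(m := 1 - sum u {1..<m}) \<in> prob_simplex m"
      using u assms unfolding prob_simplex_def m by (auto simp: PiE_iff extensional_def)
  qed
  have coord: "(\<lambda>u. u i) \<in> borel_measurable (corner_measure m)" if "i \<in> {1..<m}" for i
    unfolding corner_measure_def
    using measurable_component_singleton[OF that, of "\<lambda>_. lborel :: real measure"]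
    by (intro measurable_restrict_space1) simp
  show "(\<lambda>u. u(m := 1 - (\<Sum>i = 1..<m. u i))) \<in> corner_measure m \<rightarrow>\<^sub>M (\<Pi>\<^sub>M i\<in>{1..m}. borel)"
  proof (rule measurable_fun_upd[where J = "{1..<m}"])
    show "{1..m} = {1..<m} \<union> {m}" using m by auto
    have "(\<lambda>u. u) \<in> (\<Pi>\<^sub>M i\<in>{1..<m}. (lborel :: real measure)) \<rightarrow>\<^sub>M (\<Pi>\<^sub>M i\<in>{1..<m}. borel)"
      by (rule measurable_ident_sets) (rule sets_PiM_cong, simp_all)
    then show "(\<lambda>u. u) \<in> corner_measure m \<rightarrow>\<^sub>M (\<Pi>\<^sub>M i\<in>{1..<m}. borel)"
      unfolding corner_measure_def by (rule measurable_restrict_space1)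
    show "(\<lambda>u. 1 - (\<Sum>i = 1..<m. u i)) \<in> borel_measurable (corner_measure m)"
      by (intro borel_measurable_diff borel_measurable_const borel_measurable_sum coord)
  qed
qed

lemma uniform_simplex_eq:
  "uniform_simplex m = distr (uniform_measure (corner_measure m) (corner_simplex m)) (borel_simplex m)
    (\<lambda>u. u(m := 1 - (\<Sum>i = 1..<m. u i)))"
  by (simp add: uniform_simplex_def corner_measure_def)

lemma simplex_distribution_uniform:
  assumes "m \<ge> 1"
  shows "simplex_distribution (uniform_simplex m) m"
proof -
  interpret prob_space "uniform_measure (corner_measure m) (corner_simplex m)"
    by (rule prob_space_uniform_measure) (simp_all add: emeasure_corner_measure)
  have "prob_space (uniform_simplex m)"
    unfolding uniform_simplex_eq
    by (rule prob_space_distr) (use measurable_last_weight[OF assms] in simp)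
  then show ?thesis
    by (intro simplex_distribution.intro simplex_distribution_axioms.intro) (simp_all add: uniform_simplex_eq)
qed

text \<open>The quotient of the first moment \<open>1 / m!\<close> and the volume \<open>1 / (m - 1)!\<close> of the corner simplex.\<close>

lemma mean_weight_uniform_inner:
  assumes i: "i \<in> {1..<m}"
  shows "(\<integral>w. w i \<partial>uniform_simplex m) = 1 / real m"
proof -
  define J where "J = {1..<m} - {i}"
  have J: "finite J" "i \<notin> J" "insert i J = {1..<m}" and cJ: "card J + 2 = m"
    using i by (auto simp: J_def)
  let ?U = "uniform_measure (corner_measure m) (corner_simplex m)"
  have coord: "(\<lambda>u. u i) \<in> borel_measurable (corner_measure m)"
    unfolding corner_measure_def
    using measurable_component_singleton[OF i, of "\<lambda>_. lborel :: real measure"]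
    by (intro measurable_restrict_space1) simp
  have "(\<integral>\<^sup>+u. ennreal (u i) \<partial>?U) = (\<integral>\<^sup>+u. ennreal (u i) * indicator (corner_simplex m) u \<partial>corner_measure m)
      / ennreal (1 / fact (m - 1))"
    using coord sets.top[of "corner_measure m"]
    by (subst nn_integral_uniform_measure) (simp_all add: emeasure_corner_measure space_corner_measure)
  also have "(\<integral>\<^sup>+u. ennreal (u i) * indicator (corner_simplex m) u \<partial>corner_measure m)
      = (\<integral>\<^sup>+u. ennreal (u i) * indicator (corner_simplex m) u \<partial>(\<Pi>\<^sub>M i\<in>{1..<m}. lborel))"
    unfolding corner_measure_def
    using sets.sets_into_space[OF corner_simplex_sets[of m]] corner_simplex_sets[of m]
    by (subst nn_integral_restrict_space) (auto simp: Int_absorb2 indicator_def intro!: nn_integral_cong)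
  also have "\<dots> = (\<integral>\<^sup>+x. ennreal (x i) * indicator ({x. (\<forall>j\<in>insert i J. 0 \<le> x j) \<and> sum x (insert i J) \<le> 1}) x
      \<partial>(\<Pi>\<^sub>M j\<in>insert i J. lborel))"
    unfolding J(3) by (intro nn_integral_cong) (simp add: corner_simplex_eq indicator_def)
  also have "\<dots> = ennreal (1 / fact m)"
    unfolding nn_integral_coordinate_corner_simplex[OF J(1,2)] cJ ..
  also have "\<dots> / ennreal (1 / fact (m - 1)) = ennreal (1 / real m)"
    using i by (simp add: divide_ennreal fact_reduce[of m])
  finally have nn: "(\<integral>\<^sup>+u. ennreal (u i) \<partial>?U) = ennreal (1 / real m)" .
  have "(\<integral>w. w i \<partial>uniform_simplex m) = (\<integral>u. (u(m := 1 - (\<Sum>i = 1..<m. u i))) i \<partial>?U)"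
    unfolding uniform_simplex_eq
    by (rule integral_distr) (use measurable_last_weight[of m] measurable_weight i in auto)
  also have "\<dots> = (\<integral>u. u i \<partial>?U)" using i by (intro Bochner_Integration.integral_cong) auto
  also have "\<dots> = enn2real (\<integral>\<^sup>+u. ennreal (u i) \<partial>?U)"
  proof (rule integral_eq_nn_integral)
    show "(\<lambda>u. u i) \<in> borel_measurable ?U" using coord by simp
    show "AE u in ?U. 0 \<le> u i"
      by (rule AE_I2) (use i in \<open>auto simp: space_corner_measure corner_simplex_def PiE_iff\<close>)
  qed
  finally show ?thesis by (simp add: nn)
qed

text \<open>The last weight is determined by the others, and the means of all weights sum to \<open>1\<close>.\<close>

lemma mean_weight_uniform:
  assumes i: "i \<in> {1..m}"
  shows "(\<integral>w. w i \<partial>uniform_simplex m) = 1 / real m"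
proof (cases "i = m")
  case True
  have m: "m \<ge> 1" using i by auto
  interpret simplex_distribution "uniform_simplex m" m by (rule simplex_distribution_uniform[OF m])
  have "{1..m} = insert m {1..<m}" using m by auto
  then have "(\<integral>w. w m \<partial>uniform_simplex m) + (\<Sum>i\<in>{1..<m}. 1 / real m) = 1"
    using sum_mean_weight mean_weight_uniform_inner[of _ m] by simp
  then show ?thesis using m True by (simp add: field_simps of_nat_diff)
next
  case False
  then show ?thesis using i by (intro mean_weight_uniform_inner) auto
qed

section \<open>The mean inequalities\<close>

lemma matrix_inv_scaleR:
  assumes "pos_def A" "c \<noteq> 0"
  shows "matrix_inv ((1 / c) *\<^sub>R A) = c *\<^sub>R matrix_inv A"
  by (rule matrix_inv_eqI) (simp add: scaleR_mult_left scaleR_mult_right pos_def_matrix_inv assms)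

theorem proposition5p2:
  fixes m :: nat and \<nu> :: "(nat \<Rightarrow> real) measure" and A :: "nat \<Rightarrow> complex^'n^'n"
    and wbar :: "nat \<Rightarrow> real"
  assumes "m \<ge> 1"
    and "prob_space \<nu>"
    and "sets \<nu> = sets (borel_simplex m)"
    and "\<And>i. i \<in> {1..m} \<Longrightarrow> pos_def (A i)"
  defines "wbar \<equiv> \<lambda>i. LINT w|\<nu>. w i"
  shows "matrix_inv (\<Sum>i = 1..m. wbar i *\<^sub>R matrix_inv (A i)) \<preceq>\<^sub>L geodesic_mean m \<nu> A
       \<and> geodesic_mean m \<nu> A \<preceq>\<^sub>L (\<Sum>i = 1..m. wbar i *\<^sub>R A i)
       \<and> real m *\<^sub>R matrix_inv (\<Sum>i = 1..m. matrix_inv (A i)) \<preceq>\<^sub>L log_mean m A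
       \<and> log_mean m A \<preceq>\<^sub>L (1 / real m) *\<^sub>R (\<Sum>i = 1..m. A i)"
proof -
  note A = assms(4)
  interpret \<nu>: simplex_distribution \<nu> m
    by (intro simplex_distribution.intro simplex_distribution_axioms.intro assms)
  interpret L: simplex_distribution "uniform_simplex m" m
    by (rule simplex_distribution_uniform[OF assms(1)])
  have uniform: "(\<Sum>i=1..m. (\<integral>w. w i \<partial>uniform_simplex m) *\<^sub>R B i) = (1 / real m) *\<^sub>R (\<Sum>i=1..m. B i)"
    for B :: "nat \<Rightarrow> complex^'n^'n"
    unfolding scaleR_sum_right by (intro sum.cong refl arg_cong2[of _ _ _ _ scaleR] mean_weight_uniform)
  have "weighted_points {1..m} (\<lambda>i. 1 / real m) (\<lambda>i. matrix_inv (A i))"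
    using assms(1) by unfold_locales (auto simp: pos_def_matrix_inv(1) A)
  then have "pos_def ((1 / real m) *\<^sub>R (\<Sum>i=1..m. matrix_inv (A i)))"
    unfolding scaleR_sum_right by (rule weighted_points.pos_def_weighted_sum)
  from matrix_inv_scaleR[OF this, of "1 / real m"] assms(1)
  have inv: "matrix_inv ((1 / real m) *\<^sub>R (\<Sum>i=1..m. matrix_inv (A i)))
      = real m *\<^sub>R matrix_inv (\<Sum>i=1..m. matrix_inv (A i))"
    by simp
  have "matrix_inv (\<Sum>i=1..m. (\<integral>w. w i \<partial>uniform_simplex m) *\<^sub>R matrix_inv (A i)) \<preceq>\<^sub>L log_mean m A"
    "log_mean m A \<preceq>\<^sub>L (\<Sum>i=1..m. (\<integral>w. w i \<partial>uniform_simplex m) *\<^sub>R A i)"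
    unfolding log_mean_def by (rule L.geodesic_mean_bounds, rule A, assumption)+
  moreover have "matrix_inv (\<Sum>i = 1..m. wbar i *\<^sub>R matrix_inv (A i)) \<preceq>\<^sub>L geodesic_mean m \<nu> A"
    "geodesic_mean m \<nu> A \<preceq>\<^sub>L (\<Sum>i = 1..m. wbar i *\<^sub>R A i)"
    unfolding wbar_def by (rule \<nu>.geodesic_mean_bounds, rule A, assumption)+
  ultimately show ?thesis unfolding uniform inv by (intro conjI)
qed

end
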